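(* Let $n\ge1$ be an integer, and let $1\le p_1,p_2\le\infty$, $0<q\le\infty$ and $0<\lambda<n$ be constants which satisfy $$\frac1{p_1}+\frac1{p_2}=\frac1q+\frac{n-\lambda}{n}.$$ Denote $\vec p=(p_1,p_2)$ and, for measurable $f$ on $\mathbb R^{2n}$, let $$L_\lambda f(x)=\int_{\mathbb R^n}\frac{f(x-t,x+t)}{|t|^\lambda}\,dt,\qquad x\in\mathbb R^n .$$ Then the inequality $\|L_\lambda f\|_{L^q}\lesssim\|f\|_{L^{\vec p}}$ holds for any $f\in L^{\vec p}(\mathbb R^{2n})$ if and only if $1<p_2<q<p_1\le\infty$.
   Context: $L^{\vec p}(\mathbb R^{2n})$ is the mixed-norm Lebesgue space of measurable functions $f(x_1,x_2)$, $x_1,x_2\in\mathbb R^n$, with $\|f\|_{L^{\vec p}}=\big\|\,\|f\|_{L^{p_1}_{x_1}}\big\|_{L^{p_2}_{x_2}}<\infty$ (the norm in the first variable is innermost). $X\lesssim Y$ means $X\le CY$ with a constant $C$ independent of $f$. Convention: $1/\infty=0$. *)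

theory Defs
  imports "HOL-Analysis.Analysis" "HOL-Probability.Essential_Supremum"
begin

text \<open>Exponents and norms take values in \<^typ>\<open>ennreal\<close>, where division satisfies
  \<open>1 / \<infinity> = 0\<close>.\<close>

text \<open>The power is only used with a positive exponent, whence \<open>\<infinity>\<close> to the power \<open>r\<close> is \<open>\<infinity>\<close>.\<close>

definition ennpowr :: "ennreal \<Rightarrow> real \<Rightarrow> ennreal" where
  "ennpowr x r = (if x = \<infinity> then \<infinity> else ennreal (enn2real x powr r))"

text \<open>The Lebesgue (quasi-)norm of a nonnegative function that may take the value \<open>\<infinity>\<close>, as inner
  norms do; to be used with \<open>0 < p\<close>.\<close>

definition Lp_norm :: "ennreal \<Rightarrow> 'a measure \<Rightarrow> ('a \<Rightarrow> ennreal) \<Rightarrow> ennreal" where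
  "Lp_norm p M g =
     (if p = \<infinity> then esssup M g
      else ennpowr (\<integral>\<^sup>+ x. ennpowr (g x) (enn2real p) \<partial>M) (1 / enn2real p))"

definition mixed_norm ::
  "ennreal \<Rightarrow> ennreal \<Rightarrow> ((real^'n) \<times> (real^'n) \<Rightarrow> complex) \<Rightarrow> ennreal" where
  "mixed_norm p1 p2 f =
     Lp_norm p2 lebesgue (\<lambda>x2. Lp_norm p1 lebesgue (\<lambda>x1. ennreal (cmod (f (x1, x2)))))"

definition mixed_Lp ::
  "ennreal \<Rightarrow> ennreal \<Rightarrow> ((real^'n) \<times> (real^'n) \<Rightarrow> complex) set" where
  "mixed_Lp p1 p2 = {f \<in> borel_measurable lebesgue. mixed_norm p1 p2 f < \<infinity>}"

definition L_integrand ::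
  "real \<Rightarrow> ((real^'n) \<times> (real^'n) \<Rightarrow> complex) \<Rightarrow> real^'n \<Rightarrow> real^'n \<Rightarrow> complex" where
  "L_integrand l f x t = f (x - t, x + t) / complex_of_real (norm t powr l)"

text \<open>The Bochner integral is \<open>0\<close> when the integrand is not integrable, so that
  well-definedness of the operator has to be required separately.\<close>

definition L_op ::
  "real \<Rightarrow> ((real^'n) \<times> (real^'n) \<Rightarrow> complex) \<Rightarrow> real^'n \<Rightarrow> complex" where
  "L_op l f x = (\<integral>t. L_integrand l f x t \<partial>lebesgue)"

end

theory Submission
  imports Defs
begin

text \<open>Substituting \<open>y = x + t\<close>, the operator is
  \<open>L f(x) = \<integral> f(2x - y, y) |y - x|\<^bsup>-l\<^esup> dy\<close>. Pair it with \<open>\<phi> \<in> L\<^bsup>q'\<^esup>\<close> and apply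
  Hoelder's inequality in \<open>x\<close> with exponents \<open>p1\<close> and \<open>s = p1'\<close>, then in \<open>y\<close> with
  \<open>G = G\<^bsup>p2/p1\<^esup> G\<^bsup>1 - p2/p1\<^esup>\<close>, where \<open>G\<close> is the inner norm of \<open>f\<close>. This leaves the
  Hardy--Littlewood--Sobolev form of \<open>\<phi>\<^bsup>s\<^esup>\<close> and \<open>G\<^bsup>s(1 - p2/p1)\<^esup>\<close> with kernel
  \<open>|x - y|\<^bsup>-ls\<^esup>\<close>, whose exponents are admissible exactly when \<open>1 < p2 < q < p1\<close>.

  That form, for normalised \<open>\<psi> \<in> L\<^bsup>p\<^esup>\<close> and \<open>h \<in> L\<^bsup>r\<^esup>\<close>, is estimated by splitting
  the domain into \<open>h(y)\<^bsup>r\<^esup> \<le> \<psi>(x)\<^bsup>p\<^esup>\<close> and its complement: on the first part the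
  \<open>y\<close>-integral is at most a constant times \<open>\<psi>(x)\<^bsup>p - 1\<^esup>\<close>, by bounding \<open>h\<close> near \<open>x\<close> by
  its largest possible value and using Hoelder's inequality away from \<open>x\<close>.

  Conversely, \<open>1\<^bsub>|y| < R\<^esub> h(u - y)\<close> rules out \<open>q \<le> p2\<close>, \<open>1\<^bsub>|u + y| < R\<^esub> g(y)\<close> rules out
  \<open>p1 \<le> q\<close>, and \<open>1\<^bsub>|y| < R\<^esub> \<phi>(u)\<close> with small \<open>R\<close> rules out \<open>p2 = 1\<close>; here \<open>h\<close>,
  \<open>g\<close>, \<open>\<phi>\<close> are critical powers of the norm restricted to an annulus.\<close>

section \<open>Lebesgue norms of extended nonnegative functions\<close>

lemma ennpowr_ennreal [simp]: "0 \<le> x \<Longrightarrow> ennpowr (ennreal x) r = ennreal (x powr r)"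
  by (simp add: ennpowr_def)

lemma ennpowr_top [simp]: "ennpowr \<infinity> r = \<infinity>" "ennpowr top r = top"
  by (simp_all add: ennpowr_def)

lemma ennpowr_0 [simp]: "ennpowr 0 r = 0"
  by (simp add: ennpowr_def)

lemma ennpowr_1 [simp]: "ennpowr x 1 = x"
  by (cases x) (auto simp: ennpowr_def)

lemma ennpowr_eq_0_iff [simp]: "ennpowr x r = 0 \<longleftrightarrow> x = 0"
  by (cases x) (auto simp: ennpowr_def)

lemma ennpowr_eq_top_iff [simp]: "ennpowr x r = top \<longleftrightarrow> x = top"
  by (cases x) (auto simp: ennpowr_def)

lemma ennpowr_mono: "0 \<le> r \<Longrightarrow> x \<le> y \<Longrightarrow> ennpowr x r \<le> ennpowr y r"
  by (cases x; cases y) (auto simp: powr_mono2 ennreal_leI top_unique)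

lemma ennpowr_ennpowr [simp]: "ennpowr (ennpowr x a) b = ennpowr x (a * b)"
  by (cases x) (auto simp: powr_powr)

text \<open>Valid for every real \<open>r\<close>, negative ones included, because
  \<open>ennpowr\<close> fixes \<open>0\<close> and \<open>top\<close> and because
  \<open>0 * top = 0\<close>.\<close>

lemma ennpowr_mult: "ennpowr (x * y) r = ennpowr x r * ennpowr y r"
proof (cases "x = 0 \<or> y = 0")
  case False
  then show ?thesis
    by (cases x; cases y)
      (auto simp: powr_mult ennreal_mult[symmetric] ennreal_top_mult ennreal_mult_top)
qed auto

lemma measurable_ennpowr [measurable]:
  assumes [measurable]: "f \<in> borel_measurable M"
  shows "(\<lambda>x. ennpowr (f x) r) \<in> borel_measurable M"
  unfolding ennpowr_def by measurable

section \<open>Young's and Hoelder's inequalities for extended nonnegative values\<close>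

lemma Youngs_inequality_ennreal:
  assumes "1 < p" "1 < r" "1 / p + 1 / r = 1" "0 < a" "0 < b"
  shows "x * y \<le> ennreal (a * b / (p * a powr p)) * ennpowr x p
                + ennreal (a * b / (r * b powr r)) * ennpowr y r"
proof (cases "x = top \<or> y = top")
  case True
  then show ?thesis using assms by (auto simp: ennreal_mult_top)
next
  case False
  then obtain u v where [simp]: "x = ennreal u" "0 \<le> u" "y = ennreal v" "0 \<le> v"
    by (cases x; cases y) auto
  have "(u / a) * (v / b) \<le> (u / a) powr p / p + (v / b) powr r / r"
    using assms by (intro Youngs_inequality) auto
  then have "a * b * ((u / a) * (v / b)) \<le> a * b * ((u / a) powr p / p + (v / b) powr r / r)"
    using assms by (intro mult_left_mono) auto
  then have "u * v \<le> (a * b / (p * a powr p)) * u powr p + (a * b / (r * b powr r)) * v powr r"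
    using assms by (simp add: powr_divide field_simps)
  then show ?thesis using assms
    by (simp add: ennreal_mult[symmetric] ennreal_plus[symmetric] del: ennreal_plus)
qed

text \<open>Young's inequality is used at the scales \<open>a\<close> and \<open>b\<close>: after
  integration the two terms are at most \<open>a * b / p\<close> and \<open>a * b / r\<close>, which
  add up to \<open>a * b\<close>. Positive real bounds in place of norms spare the applications a
  case distinction on vanishing or infinite norms.\<close>

lemma Holder_nn_integral_bound:
  assumes [measurable]: "f \<in> borel_measurable M" "g \<in> borel_measurable M"
    and pr: "1 < p" "1 < r" "1 / p + 1 / r = 1" and ab: "0 < a" "0 < b"
    and f: "(\<integral>\<^sup>+x. ennpowr (f x) p \<partial>M) \<le> ennreal (a powr p)"
    and g: "(\<integral>\<^sup>+x. ennpowr (g x) r \<partial>M) \<le> ennreal (b powr r)"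
  shows "(\<integral>\<^sup>+x. f x * g x \<partial>M) \<le> ennreal (a * b)"
proof -
  have "(\<integral>\<^sup>+x. f x * g x \<partial>M) \<le> (\<integral>\<^sup>+x. ennreal (a * b / (p * a powr p)) * ennpowr (f x) p
                + ennreal (a * b / (r * b powr r)) * ennpowr (g x) r \<partial>M)"
    by (intro nn_integral_mono Youngs_inequality_ennreal pr ab)
  also have "\<dots> = ennreal (a * b / (p * a powr p)) * (\<integral>\<^sup>+x. ennpowr (f x) p \<partial>M)
                + ennreal (a * b / (r * b powr r)) * (\<integral>\<^sup>+x. ennpowr (g x) r \<partial>M)"
    by (simp add: nn_integral_add nn_integral_cmult)
  also have "\<dots> \<le> ennreal (a * b / (p * a powr p)) * ennreal (a powr p)
                + ennreal (a * b / (r * b powr r)) * ennreal (b powr r)"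
    by (intro add_mono mult_left_mono f g) auto
  also have "\<dots> = ennreal (a * b / p + a * b / r)"
    using pr ab by (simp add: ennreal_mult[symmetric] ennreal_plus[symmetric] del: ennreal_plus)
  also have "a * b / p + a * b / r = a * b * (1 / p + 1 / r)"
    by (simp add: field_simps)
  finally show ?thesis by (simp add: pr)
qed

text \<open>Finite nonzero norms are inserted as the bounds \<open>a\<close> and \<open>b\<close>.
  If a norm vanishes, the product vanishes almost everywhere; otherwise an infinite norm makes the
  right side infinite.\<close>

lemma Holder_nn_integral:
  assumes [measurable]: "f \<in> borel_measurable M" "g \<in> borel_measurable M"
    and pr: "1 < p" "1 < r" "1 / p + 1 / r = 1"
  shows "(\<integral>\<^sup>+x. f x * g x \<partial>M)
    \<le> ennpowr (\<integral>\<^sup>+x. ennpowr (f x) p \<partial>M) (1 / p) * ennpowr (\<integral>\<^sup>+x. ennpowr (g x) r \<partial>M) (1 / r)"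
    (is "_ \<le> ennpowr ?A _ * ennpowr ?B _")
proof -
  consider "?A = 0 \<or> ?B = 0" | "?A = top" "?B \<noteq> 0" | "?B = top" "?A \<noteq> 0"
    | "?A \<noteq> 0" "?A \<noteq> top" "?B \<noteq> 0" "?B \<noteq> top" by blast
  then show ?thesis
  proof cases
    case 1
    then have "(AE x in M. f x = 0) \<or> (AE x in M. g x = 0)"
      by (auto simp: nn_integral_0_iff_AE)
    then have "AE x in M. f x * g x = 0" by auto
    then have "(\<integral>\<^sup>+x. f x * g x \<partial>M) = 0" by (simp add: nn_integral_0_iff_AE)
    then show ?thesis by simp
  next
    case 4
    then obtain A B where AB: "?A = ennreal A" "0 < A" "?B = ennreal B" "0 < B"
      by (cases ?A; cases ?B) (auto simp: less_le)
    have "(\<integral>\<^sup>+x. f x * g x \<partial>M) \<le> ennreal (A powr (1 / p) * B powr (1 / r))"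
      using pr AB by (intro Holder_nn_integral_bound[where p=p and r=r]) (auto simp: powr_powr)
    then show ?thesis using AB by (simp add: ennreal_mult)
  qed (auto simp: ennreal_mult_top ennreal_top_mult)
qed

section \<open>Lebesgue norms for finite and infinite exponents\<close>

lemma Lp_norm_infinity [simp]: "Lp_norm \<infinity> M g = esssup M g" "Lp_norm top M g = esssup M g"
  by (simp_all add: Lp_norm_def)

lemma Lp_norm_real: "0 < p \<Longrightarrow> Lp_norm (ennreal p) M g = ennpowr (\<integral>\<^sup>+x. ennpowr (g x) p \<partial>M) (1 / p)"
  by (simp add: Lp_norm_def)

text \<open>An exponent is read through its reciprocal \<open>enn2real (1 / p)\<close>, which is
  \<open>0\<close> at infinity, so that expressions such as \<open>m powr enn2real (1 / p)\<close>
  cover both cases at once.\<close>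

lemma exponent_cases [case_names infinity real]:
  assumes "0 < (p::ennreal)"
  obtains "p = \<infinity>" "enn2real (1 / p) = 0"
    | r where "0 < r" "p = ennreal r" "enn2real (1 / p) = 1 / r"
proof (cases p)
  case (real r)
  then have "0 < r" using assms by (auto simp: less_le)
  moreover have "1 / p = ennreal (1 / r)" using real \<open>0 < r\<close>
    by (metis divide_ennreal ennreal_1 zero_le_one)
  ultimately show ?thesis using real that(2) by auto
qed (use that in auto)

lemma Lp_norm_mono_AE:
  assumes "0 < p" and "f \<in> borel_measurable M" and le: "AE x in M. f x \<le> g x"
  shows "Lp_norm p M f \<le> Lp_norm p M g"
  using assms(1)
proof (cases p rule: exponent_cases)
  case infinity
  then show ?thesis using assms by (simp add: esssup_AE_mono)
next
  case (real r)
  have "AE x in M. ennpowr (f x) r \<le> ennpowr (g x) r"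
    using le by eventually_elim (use real in \<open>simp add: ennpowr_mono\<close>)
  then show ?thesis using real
    by (auto simp: Lp_norm_real intro!: ennpowr_mono nn_integral_mono_AE)
qed

lemma Lp_norm_mono:
  "0 < p \<Longrightarrow> f \<in> borel_measurable M \<Longrightarrow> (\<And>x. f x \<le> g x) \<Longrightarrow> Lp_norm p M f \<le> Lp_norm p M g"
  by (rule Lp_norm_mono_AE) auto

lemma Lp_norm_completion:
  assumes "0 < p" "f \<in> borel_measurable M"
  shows "Lp_norm p (completion M) f = Lp_norm p M f"
  using assms(1)
proof (cases p rule: exponent_cases)
  case infinity
  then show ?thesis using assms
    by (simp add: esssup_eq_AE AE_completion_iff measurable_completion)
qed (simp add: Lp_norm_real nn_integral_completion)

lemma Lp_norm_cmult_le:
  assumes "0 < p" and [measurable]: "g \<in> borel_measurable M"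
  shows "Lp_norm p M (\<lambda>x. c * g x) \<le> c * Lp_norm p M g"
  using assms(1)
proof (cases p rule: exponent_cases)
  case infinity
  have "AE x in M. g x \<le> esssup M g" by (rule esssup_AE)
  then have "AE x in M. c * g x \<le> c * esssup M g"
    by eventually_elim (simp add: mult_left_mono)
  then show ?thesis using infinity by (simp add: esssup_I)
next
  case (real r)
  then show ?thesis by (simp add: Lp_norm_real ennpowr_mult nn_integral_cmult)
qed

text \<open>For \<open>p = \<infinity>\<close> the power is \<open>m powr 0 = 1\<close>, and
  positivity of the measure makes the essential supremum attain the value \<open>c\<close>.\<close>

lemma Lp_norm_cindicator:
  assumes "0 < p" "S \<in> sets M" "emeasure M S = ennreal m" "0 < m"
  shows "Lp_norm p M (\<lambda>x. c * indicator S x) = c * ennreal (m powr enn2real (1 / p))"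
  using assms(1)
proof (cases p rule: exponent_cases)
  case infinity
  have "esssup M (\<lambda>x. c * indicator S x) = c"
  proof (rule antisym)
    show "esssup M (\<lambda>x. c * indicator S x) \<le> c"
      using assms by (intro esssup_I) (auto split: split_indicator)
    have "AE x in M. c * indicator S x \<le> esssup M (\<lambda>x. c * indicator S x)" by (rule esssup_AE)
    then have *: "AE x in M. x \<in> S \<longrightarrow> c \<le> esssup M (\<lambda>x. c * indicator S x)"
      by eventually_elim auto
    show "c \<le> esssup M (\<lambda>x. c * indicator S x)"
    proof (rule ccontr)
      assume "\<not> ?thesis"
      with * have "AE x in M. x \<notin> S" by auto
      then have "emeasure M S = 0"
        using assms(2) by (simp add: AE_iff_null_sets[symmetric] null_setsD1)
      then show False using assms by simp
    qed
  qed
  then show ?thesis using infinity assms by simp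
next
  case (real r)
  have "(\<integral>\<^sup>+x. ennpowr (c * indicator S x) r \<partial>M) = (\<integral>\<^sup>+x. ennpowr c r * indicator S x \<partial>M)"
    by (intro nn_integral_cong) (auto split: split_indicator)
  then show ?thesis using real assms
    by (simp add: Lp_norm_real nn_integral_cmult_indicator ennpowr_mult)
qed

text \<open>Here \<open>s\<close> is conjugate to \<open>p\<close>. For infinite \<open>p\<close> it
  equals \<open>1\<close>, and \<open>f\<close> is replaced by its essential supremum.\<close>

lemma Holder_Lp_norm:
  assumes [measurable]: "f \<in> borel_measurable M" "g \<in> borel_measurable M"
    and "1 < p" and s: "enn2real (1 / p) + 1 / s = 1"
  shows "(\<integral>\<^sup>+x. f x * g x \<partial>M) \<le> Lp_norm p M f * ennpowr (\<integral>\<^sup>+x. ennpowr (g x) s \<partial>M) (1 / s)"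
proof -
  have "0 < p" using assms by (meson less_trans zero_less_one)
  then show ?thesis
  proof (cases p rule: exponent_cases)
    case infinity
    with s have [simp]: "s = 1" by simp
    have "(\<integral>\<^sup>+x. f x * g x \<partial>M) \<le> (\<integral>\<^sup>+x. esssup M f * g x \<partial>M)"
    proof (rule nn_integral_mono_AE)
      show "AE x in M. f x * g x \<le> esssup M f * g x"
        using esssup_AE[of f M] by eventually_elim (rule mult_right_mono, auto)
    qed
    also have "\<dots> = esssup M f * (\<integral>\<^sup>+x. g x \<partial>M)" by (simp add: nn_integral_cmult)
    finally show ?thesis using infinity by simp
  next
    case (real r)
    have "1 < r" using real assms(3) by (metis ennreal_1 ennreal_less_iff zero_le_one)
    moreover have "1 < s"
    proof -
      have "1 / s = 1 - 1 / r" using s real by simp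
      then have "0 < 1 / s" "1 / s < 1" using \<open>1 < r\<close> by auto
      then show ?thesis by (simp add: field_simps zero_less_divide_iff)
    qed
    ultimately show ?thesis using real s
      by (simp add: Lp_norm_real Holder_nn_integral)
  qed
qed

text \<open>For real \<open>p\<close> this is part of Tonelli's theorem. The essential supremum is
  not an integral, so its superlevel sets are examined instead.\<close>

lemma measurable_Lp_norm_Pair:
  assumes "sigma_finite_measure M" "0 < p"
    and F[measurable]: "F \<in> borel_measurable (M \<Otimes>\<^sub>M N)"
  shows "(\<lambda>y. Lp_norm p M (\<lambda>u. F (u, y))) \<in> borel_measurable N"
  using assms(2)
proof (cases p rule: exponent_cases)
  case infinity
  interpret sigma_finite_measure M by fact
  have F'[measurable]: "(\<lambda>z. F (snd z, fst z)) \<in> borel_measurable (N \<Otimes>\<^sub>M M)" by measurable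
  have "(\<lambda>y. esssup M (\<lambda>u. F (u, y))) \<in> borel_measurable N"
  proof (rule borel_measurableI_greater)
    fix c
    \<comment> \<open>The essential supremum exceeds \<open>c\<close> exactly if the section exceeds
      \<open>c\<close> on a set of positive measure, and that measure is measurable in
      \<open>y\<close>.\<close>
    have *: "c < esssup M (\<lambda>u. F (u, y)) \<longleftrightarrow> emeasure M {u \<in> space M. c < F (u, y)} \<noteq> 0"
      if y: "y \<in> space N" for y
    proof -
      have [measurable]: "(\<lambda>u. F (u, y)) \<in> borel_measurable M" using y by measurable
      show ?thesis
      proof
        assume "c < esssup M (\<lambda>u. F (u, y))"
        then show "emeasure M {u \<in> space M. c < F (u, y)} \<noteq> 0"
          using esssup_pos_measure[of "\<lambda>u. F (u, y)" M c] by simp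
      next
        assume pos: "emeasure M {u \<in> space M. c < F (u, y)} \<noteq> 0"
        show "c < esssup M (\<lambda>u. F (u, y))"
        proof (rule ccontr)
          assume "\<not> ?thesis"
          then have "emeasure M {u \<in> space M. c < F (u, y)}
            \<le> emeasure M {u \<in> space M. esssup M (\<lambda>u. F (u, y)) < F (u, y)}"
            by (intro emeasure_mono) auto
          then show False using pos by (simp add: esssup_zero_measure)
        qed
      qed
    qed
    have "{y \<in> space N. c < esssup M (\<lambda>u. F (u, y))}
        = {y \<in> space N. emeasure M {u \<in> space M. c < F (u, y)} \<noteq> 0}"
      using * by auto
    also have "\<dots> \<in> sets N" by measurable
    finally show "{y \<in> space N. c < esssup M (\<lambda>u. F (u, y))} \<in> sets N" .
  qed
  then show ?thesis using infinity by simp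
next
  case (real r)
  interpret sigma_finite_measure M by fact
  have [measurable]: "(\<lambda>(y, u). ennpowr (F (u, y)) r) \<in> borel_measurable (N \<Otimes>\<^sub>M M)" by measurable
  show ?thesis using real by (simp add: Lp_norm_real)
qed

section \<open>Powers of the norm\<close>

lemma nn_integral_lborel_affine:
  fixes f :: "'a::euclidean_space \<Rightarrow> ennreal"
  assumes [measurable]: "f \<in> borel_measurable borel" and c: "c \<noteq> 0"
  shows "(\<integral>\<^sup>+x. f x \<partial>lborel) = ennreal (\<bar>c\<bar> ^ DIM('a)) * (\<integral>\<^sup>+x. f (t + c *\<^sub>R x) \<partial>lborel)"
  by (subst lborel_affine[OF c, of t])
     (simp add: nn_integral_density nn_integral_distr nn_integral_cmult ennreal_power)

lemma nn_integral_lborel_diff: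
  fixes f :: "'a::euclidean_space \<Rightarrow> ennreal"
  assumes "f \<in> borel_measurable borel"
  shows "(\<integral>\<^sup>+y. f (x - y) \<partial>lborel) = (\<integral>\<^sup>+y. f y \<partial>lborel)"
  using nn_integral_lborel_affine[OF assms, of "-1" x] by simp

text \<open>The change of variables, applied to the indicator of a null set containing the
  exceptional points, shows that its preimage is null as well.\<close>

lemma AE_lborel_affine:
  fixes t :: "'a::euclidean_space"
  assumes "AE x in lborel. P x" "c \<noteq> 0"
  shows "AE x in lborel. P (t + c *\<^sub>R x)"
proof -
  obtain N where N: "{x. \<not> P x} \<subseteq> N" "N \<in> null_sets lborel"
    using assms(1) by (auto simp: eventually_ae_filter)
  have [measurable]: "N \<in> sets borel" using N(2) by auto
  have "(\<integral>\<^sup>+x. indicator N x \<partial>(lborel :: 'a measure)) = 0"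
    using N(2) by auto
  then have "(\<integral>\<^sup>+x. indicator N (t + c *\<^sub>R x) \<partial>lborel) = 0"
    using assms(2) by (subst (asm) nn_integral_lborel_affine[of _ c t]) auto
  then have "AE x in lborel. t + c *\<^sub>R x \<notin> N"
    by (subst (asm) nn_integral_0_iff_AE) (auto simp: indicator_def split: if_splits)
  then show ?thesis by eventually_elim (use N(1) in auto)
qed

text \<open>On the shell of radius \<open>\<rho> * \<sigma> ^ k\<close> the integrand is at most
  \<open>w k\<close>, and the shell lies in a ball of volume proportional to
  \<open>(\<rho> * \<sigma> ^ k) powr n\<close>. The products form a geometric series of ratio
  \<open>\<sigma> powr (n - \<mu>)\<close>. Shrinking shells serve for balls, growing ones for their
  exteriors.\<close>

lemma nn_integral_norm_powr_shells:
  fixes S :: "'a::euclidean_space set"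
  defines "n \<equiv> real DIM('a)"
  assumes \<mu>: "0 \<le> \<mu>" and \<sigma>: "0 < \<sigma>" "\<sigma> powr (n - \<mu>) < 1" and \<rho>: "0 < \<rho>"
    and S: "\<And>x. x \<in> S \<Longrightarrow> x \<noteq> 0 \<Longrightarrow> \<exists>k. \<rho> * \<sigma> ^ k \<le> norm x \<and> norm x \<le> 2 * \<rho> * \<sigma> ^ k"
  shows "(\<integral>\<^sup>+x. ennreal (norm x powr - \<mu>) * indicator S x \<partial>lborel)
    \<le> ennreal (unit_ball_vol n * 2 ^ DIM('a) / (1 - \<sigma> powr (n - \<mu>)) * \<rho> powr (n - \<mu>))"
proof -
  define B where "B k = cball (0::'a) (2 * \<rho> * \<sigma> ^ k)" for k
  define w where "w k = (\<rho> * \<sigma> ^ k) powr - \<mu>" for k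
  have [measurable]: "B k \<in> sets borel" for k by (simp add: B_def)
  have pos: "0 < \<rho> * \<sigma> ^ k" for k using \<sigma> \<rho> by simp
  have "(\<integral>\<^sup>+x. ennreal (norm x powr - \<mu>) * indicator S x \<partial>lborel)
    \<le> (\<integral>\<^sup>+x. (\<Sum>k. ennreal (w k) * indicator (B k) x) \<partial>lborel)"
  proof (rule nn_integral_mono)
    fix x :: 'a
    show "ennreal (norm x powr - \<mu>) * indicator S x \<le> (\<Sum>k. ennreal (w k) * indicator (B k) x)"
    proof (cases "x \<in> S \<and> x \<noteq> 0")
      case True
      then obtain k where k: "\<rho> * \<sigma> ^ k \<le> norm x" "norm x \<le> 2 * \<rho> * \<sigma> ^ k" using S by blast
      have "ennreal (norm x powr - \<mu>) * indicator S x \<le> ennreal (w k) * indicator (B k) x"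
        using k True \<mu> pos[of k] by (auto simp: w_def B_def intro!: ennreal_leI powr_mono2')
      also have "\<dots> \<le> (\<Sum>k. ennreal (w k) * indicator (B k) x)"
        using sum_le_suminf[of "\<lambda>k. ennreal (w k) * indicator (B k) x" "{k}"]
        by (simp del: sum_mult_indicator)
      finally show ?thesis .
    qed auto
  qed
  also have "\<dots> = (\<Sum>k. ennreal (w k) * emeasure lborel (B k))"
    by (subst nn_integral_suminf) (auto simp: nn_integral_cmult_indicator)
  also have "\<dots> = (\<Sum>k. ennreal ((unit_ball_vol n * 2 ^ DIM('a) * \<rho> powr (n - \<mu>)) * (\<sigma> powr (n - \<mu>)) ^ k))"
  proof (rule suminf_cong)
    fix k
    have "ennreal (w k) * emeasure lborel (B k) = ennreal (w k * (unit_ball_vol n * (2 * \<rho> * \<sigma> ^ k) ^ DIM('a)))"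
      using pos[of k] \<sigma> \<rho> unfolding B_def by (subst emeasure_cball) (auto simp: w_def n_def ennreal_mult)
    also have "w k * (unit_ball_vol n * (2 * \<rho> * \<sigma> ^ k) ^ DIM('a))
        = unit_ball_vol n * 2 ^ DIM('a) * (w k * (\<rho> * \<sigma> ^ k) powr n)"
      using pos[of k] by (simp add: n_def powr_realpow power_mult_distrib)
    also have "w k * (\<rho> * \<sigma> ^ k) powr n = (\<rho> * \<sigma> ^ k) powr (n - \<mu>)"
      by (simp add: w_def powr_add[symmetric])
    also have "\<dots> = \<rho> powr (n - \<mu>) * (\<sigma> powr (n - \<mu>)) ^ k"
      using \<rho> \<sigma> by (simp add: powr_mult powr_realpow[symmetric] powr_powr mult.commute)
    finally show "ennreal (w k) * emeasure lborel (B k)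
      = ennreal ((unit_ball_vol n * 2 ^ DIM('a) * \<rho> powr (n - \<mu>)) * (\<sigma> powr (n - \<mu>)) ^ k)"
      by (simp add: mult.assoc)
  qed
  also have "\<dots> = ennreal (\<Sum>k. (unit_ball_vol n * 2 ^ DIM('a) * \<rho> powr (n - \<mu>)) * (\<sigma> powr (n - \<mu>)) ^ k)"
    using \<sigma> by (intro suminf_ennreal2 summable_mult summable_geometric) (auto simp: n_def)
  also have "(\<Sum>k. (unit_ball_vol n * 2 ^ DIM('a) * \<rho> powr (n - \<mu>)) * (\<sigma> powr (n - \<mu>)) ^ k)
     = unit_ball_vol n * 2 ^ DIM('a) / (1 - \<sigma> powr (n - \<mu>)) * \<rho> powr (n - \<mu>)"
    using \<sigma> by (subst suminf_mult) (auto simp: suminf_geometric summable_geometric)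
  finally show ?thesis .
qed

text \<open>Shells with \<open>\<sigma> = 1 / 2\<close>; the ratio is below \<open>1\<close> because
  \<open>\<mu>\<close> is less than the dimension.\<close>

lemma nn_integral_norm_powr_ball:
  fixes \<mu> :: real
  assumes \<mu>: "0 \<le> \<mu>" "\<mu> < real DIM('a::euclidean_space)"
  obtains C where "0 < C"
    "\<And>\<rho>. 0 < \<rho> \<Longrightarrow> (\<integral>\<^sup>+x. ennreal (norm (x::'a) powr - \<mu>) * indicator {x. norm x < \<rho>} x \<partial>lborel)
        \<le> ennreal (C * \<rho> powr (real DIM('a) - \<mu>))"
proof
  let ?n = "real DIM('a)" and ?\<sigma> = "1 / 2 :: real"
  have \<sigma>: "0 < ?\<sigma>" "?\<sigma> powr (?n - \<mu>) < 1"
    using \<mu> by (auto simp: powr_def mult_less_0_iff ln_div)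
  then show "0 < unit_ball_vol ?n * 2 ^ DIM('a) / (1 - ?\<sigma> powr (?n - \<mu>))"
    by (intro divide_pos_pos) auto
  fix \<rho> :: real assume \<rho>: "0 < \<rho>"
  show "(\<integral>\<^sup>+x. ennreal (norm (x::'a) powr - \<mu>) * indicator {x. norm x < \<rho>} x \<partial>lborel)
        \<le> ennreal (unit_ball_vol ?n * 2 ^ DIM('a) / (1 - ?\<sigma> powr (?n - \<mu>)) * \<rho> powr (?n - \<mu>))"
  proof (rule nn_integral_norm_powr_shells[OF \<mu>(1) \<sigma> \<rho>])
    fix x :: 'a assume x: "x \<in> {x. norm x < \<rho>}" "x \<noteq> 0"
    define P where "P k \<longleftrightarrow> \<rho> * ?\<sigma> ^ k \<le> norm x" for k
    obtain k where "?\<sigma> ^ k < norm x / \<rho>"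
      using real_arch_pow_inv[of "norm x / \<rho>" ?\<sigma>] x \<rho> by auto
    then have "P k" using \<rho> by (simp add: P_def field_simps)
    \<comment> \<open>The least index is not \<open>0\<close> since \<open>norm x < \<rho>\<close>,
      and the failure of \<open>P\<close> at its predecessor is the upper bound.\<close>
    define m where "m = (LEAST k. P k)"
    have m: "P m" unfolding m_def using \<open>P k\<close> by (rule LeastI)
    have "m \<noteq> 0" using m x by (auto simp: P_def intro!: gr0I)
    then obtain j where j: "m = Suc j" using not0_implies_Suc by blast
    have "\<not> P j" using j unfolding m_def by (metis lessI not_less_Least)
    then show "\<exists>k. \<rho> * ?\<sigma> ^ k \<le> norm x \<and> norm x \<le> 2 * \<rho> * ?\<sigma> ^ k"
      using m j by (intro exI[of _ m]) (auto simp: P_def)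
  qed
qed

text \<open>Shells with \<open>\<sigma> = 2\<close>; the ratio is below \<open>1\<close> because
  \<open>\<mu>\<close> exceeds the dimension.\<close>

lemma nn_integral_norm_powr_outside_ball:
  fixes \<mu> :: real
  assumes \<mu>: "real DIM('a::euclidean_space) < \<mu>"
  obtains C where "0 < C"
    "\<And>\<rho>. 0 < \<rho> \<Longrightarrow> (\<integral>\<^sup>+x. ennreal (norm (x::'a) powr - \<mu>) * indicator {x. \<rho> \<le> norm x} x \<partial>lborel)
        \<le> ennreal (C * \<rho> powr (real DIM('a) - \<mu>))"
proof
  let ?n = "real DIM('a)" and ?\<sigma> = "2 :: real"
  have \<mu>0: "0 \<le> \<mu>" using \<mu> by linarith
  have \<sigma>: "0 < ?\<sigma>" "?\<sigma> powr (?n - \<mu>) < 1"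
    using \<mu> by (auto simp: powr_def mult_less_0_iff)
  then show "0 < unit_ball_vol ?n * 2 ^ DIM('a) / (1 - ?\<sigma> powr (?n - \<mu>))"
    by (intro divide_pos_pos) auto
  fix \<rho> :: real assume \<rho>: "0 < \<rho>"
  show "(\<integral>\<^sup>+x. ennreal (norm (x::'a) powr - \<mu>) * indicator {x. \<rho> \<le> norm x} x \<partial>lborel)
        \<le> ennreal (unit_ball_vol ?n * 2 ^ DIM('a) / (1 - ?\<sigma> powr (?n - \<mu>)) * \<rho> powr (?n - \<mu>))"
  proof (rule nn_integral_norm_powr_shells[OF \<mu>0 \<sigma> \<rho>])
    fix x :: 'a assume x: "x \<in> {x. \<rho> \<le> norm x}" "x \<noteq> 0"
    define P where "P k \<longleftrightarrow> norm x \<le> 2 * \<rho> * ?\<sigma> ^ k" for k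
    obtain k where "norm x / \<rho> < ?\<sigma> ^ k"
      using real_arch_pow[of ?\<sigma> "norm x / \<rho>"] by auto
    then have "norm x < \<rho> * ?\<sigma> ^ k" using \<rho> by (simp add: field_simps)
    then have "P k" using norm_ge_zero[of x] unfolding P_def by linarith
    define m where "m = (LEAST k. P k)"
    have m: "P m" unfolding m_def using \<open>P k\<close> by (rule LeastI)
    have "\<rho> * ?\<sigma> ^ m \<le> norm x"
    \<comment> \<open>For \<open>m = 0\<close> the lower bound is membership in the exterior,
      otherwise it is the failure of \<open>P\<close> at the predecessor.\<close>
    proof (cases m)
      case (Suc j)
      then have "\<not> P j" unfolding m_def by (metis lessI not_less_Least)
      then show ?thesis using Suc by (auto simp: P_def)
    qed (use x in auto)
    then show "\<exists>k. \<rho> * ?\<sigma> ^ k \<le> norm x \<and> norm x \<le> 2 * \<rho> * ?\<sigma> ^ k"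
      using m by (intro exI[of _ m]) (auto simp: P_def)
  qed
qed

text \<open>The measure \<open>|x|\<^sup>-\<^sup>n dx\<close> is invariant under dilations, so every dyadic shell has the
  same mass.\<close>

lemma nn_integral_norm_powr_annulus_scale:
  fixes r R s :: real
  assumes "0 < s"
  shows "(\<integral>\<^sup>+x. ennreal (norm (x::'a::euclidean_space) powr - real DIM('a))
            * indicator {x. s * r \<le> norm x \<and> norm x < s * R} x \<partial>lborel)
       = (\<integral>\<^sup>+x. ennreal (norm (x::'a) powr - real DIM('a))
            * indicator {x. r \<le> norm x \<and> norm x < R} x \<partial>lborel)"
proof -
  let ?n = "real DIM('a)"
  have "(\<integral>\<^sup>+x. ennreal (norm (x::'a) powr - ?n) * indicator {x. s * r \<le> norm x \<and> norm x < s * R} x \<partial>lborel)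
     = ennreal (s ^ DIM('a)) * (\<integral>\<^sup>+x. ennreal (norm (s *\<^sub>R (x::'a)) powr - ?n)
            * indicator {x. s * r \<le> norm x \<and> norm x < s * R} (s *\<^sub>R x) \<partial>lborel)"
    using assms by (subst nn_integral_lborel_affine[of _ s 0]) auto
  also have "\<dots> = (\<integral>\<^sup>+x. ennreal (s ^ DIM('a)) * (ennreal (norm (s *\<^sub>R (x::'a)) powr - ?n)
            * indicator {x. s * r \<le> norm x \<and> norm x < s * R} (s *\<^sub>R x)) \<partial>lborel)"
    by (subst nn_integral_cmult) auto
  also have "\<dots> = (\<integral>\<^sup>+x. ennreal (norm (x::'a) powr - ?n)
            * indicator {x. r \<le> norm x \<and> norm x < R} x \<partial>lborel)"
  proof (rule nn_integral_cong)
    fix x :: 'a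
    have "s ^ DIM('a) * (s * norm x) powr - ?n = norm x powr - ?n"
      using assms by (simp add: powr_mult powr_minus powr_realpow)
    moreover have "(s *\<^sub>R x \<in> {x. s * r \<le> norm x \<and> norm x < s * R}) \<longleftrightarrow> x \<in> {x. r \<le> norm x \<and> norm x < R}"
      using assms by auto
    ultimately show "ennreal (s ^ DIM('a)) * (ennreal (norm (s *\<^sub>R x) powr - ?n)
            * indicator {x. s * r \<le> norm x \<and> norm x < s * R} (s *\<^sub>R x))
          = ennreal (norm x powr - ?n) * indicator {x. r \<le> norm x \<and> norm x < R} x"
      using assms by (simp add: indicator_def ennreal_mult[symmetric])
  qed
  finally show ?thesis .
qed

text \<open>The annulus consists of \<open>k\<close> dyadic shells of equal mass \<open>a\<close>:
  this is the logarithmic divergence at the origin. The linear growth in \<open>k\<close> drives the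
  borderline counterexamples.\<close>

lemma nn_integral_norm_powr_annulus:
  obtains a where "0 < a"
    "\<And>k. (\<integral>\<^sup>+x. ennreal (norm (x::'a::euclidean_space) powr - real DIM('a))
            * indicator {x. (1/2) ^ k \<le> norm x \<and> norm x < 1} x \<partial>lborel) = ennreal (a * real k)"
proof -
  let ?n = "real DIM('a)"
  define I where "I r R = (\<integral>\<^sup>+x. ennreal (norm (x::'a) powr - ?n) * indicator {x. r \<le> norm x \<and> norm x < R} x \<partial>lborel)"
    for r R
  have shell: "I ((1/2) ^ Suc k) ((1/2) ^ k) = I (1/2) 1" for k
    using nn_integral_norm_powr_annulus_scale[of "(1/2) ^ k" "1/2" 1, where 'a='a] by (simp add: I_def mult.commute)
  have step: "I ((1/2) ^ Suc k) 1 = I (1/2) 1 + I ((1/2) ^ k) 1" for k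
  proof -
    have "(1/2) ^ k \<le> (1::real)" by (simp add: power_le_one)
    have "I ((1/2) ^ Suc k) 1 = (\<integral>\<^sup>+x. ennreal (norm (x::'a) powr - ?n) * indicator {x. (1/2) ^ Suc k \<le> norm x \<and> norm x < (1/2) ^ k} x
         + ennreal (norm (x::'a) powr - ?n) * indicator {x. (1/2) ^ k \<le> norm x \<and> norm x < 1} x \<partial>lborel)"
      unfolding I_def
    proof (rule nn_integral_cong)
      fix x :: 'a
      have "(1/2) ^ k \<le> norm x \<Longrightarrow> (1/2) ^ Suc k \<le> norm x"
        by (rule order_trans[rotated]) auto
      with \<open>(1/2) ^ k \<le> (1::real)\<close> show "ennreal (norm x powr - ?n) * indicator {x. (1/2) ^ Suc k \<le> norm x \<and> norm x < 1} x =
          ennreal (norm x powr - ?n) * indicator {x. (1/2) ^ Suc k \<le> norm x \<and> norm x < (1/2) ^ k} x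
         + ennreal (norm x powr - ?n) * indicator {x. (1/2) ^ k \<le> norm x \<and> norm x < 1} x"
        by (auto simp: indicator_def simp del: power_Suc)
    qed
    also have "\<dots> = I ((1/2) ^ Suc k) ((1/2) ^ k) + I ((1/2) ^ k) 1"
      unfolding I_def by (intro nn_integral_add) auto
    finally show ?thesis unfolding shell .
  qed
  \<comment> \<open>The outermost shell has positive finite volume, and on it the weight lies
    between \<open>1\<close> and \<open>(1/2) powr - ?n\<close>; hence its mass is positive and
    finite.\<close>
  define S where "S = ball (0::'a) 1 - ball 0 (1/2)"
  have "emeasure lborel S = emeasure lborel (ball (0::'a) 1) - emeasure lborel (ball (0::'a) (1/2))"
    unfolding S_def by (rule emeasure_Diff) (auto simp: emeasure_ball)
  also have "\<dots> = ennreal (unit_ball_vol ?n * (1 - (1/2) ^ DIM('a)))"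
    by (simp add: emeasure_ball ennreal_minus right_diff_distrib)
  finally have S: "emeasure lborel S = ennreal (unit_ball_vol ?n * (1 - (1/2) ^ DIM('a)))" .
  have I_S: "I (1/2) 1 = (\<integral>\<^sup>+x. ennreal (norm (x::'a) powr - ?n) * indicator S x \<partial>lborel)"
    unfolding I_def S_def by (intro nn_integral_cong) (auto simp: indicator_def)
  have "emeasure lborel S = (\<integral>\<^sup>+x. indicator S x \<partial>lborel)" by (simp add: S_def)
  also have "\<dots> \<le> I (1/2) 1"
    unfolding I_S
  proof (intro nn_integral_mono)
    fix x :: 'a
    have "1 \<le> norm x powr - ?n" if "x \<in> S"
    proof -
      have "1 powr - ?n \<le> norm x powr - ?n" using that by (intro powr_mono2') (auto simp: S_def)
      then show ?thesis by simp
    qed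
    then show "indicator S x \<le> ennreal (norm x powr - ?n) * indicator S x"
      by (auto simp: indicator_def)
  qed
  finally have lo: "emeasure lborel S \<le> I (1/2) 1" .
  have "I (1/2) 1 \<le> (\<integral>\<^sup>+x. ennreal ((1/2) powr - ?n) * indicator S x \<partial>lborel)"
    unfolding I_S by (intro nn_integral_mono) (auto simp: indicator_def S_def intro!: ennreal_leI powr_mono2')
  also have "\<dots> < top" using S by (simp add: nn_integral_cmult_indicator S_def ennreal_mult_less_top)
  finally have hi: "I (1/2) 1 < top" .
  have "0 < emeasure lborel S" unfolding S by (auto simp: power_Suc_less_one power_less_one_iff)
  then have "0 < I (1/2) 1" using lo by order
  with hi obtain a where a: "0 < a" "I (1/2) 1 = ennreal a"
    by (cases "I (1/2) 1") auto
  have "I ((1/2) ^ k) 1 = ennreal (a * real k)" for k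
  proof (induction k)
    case 0
    have "I 1 1 = (\<integral>\<^sup>+(x::'a). 0 \<partial>lborel)"
      unfolding I_def by (intro nn_integral_cong) (auto simp: indicator_def)
    then show ?case by simp
  next
    case (Suc k)
    show ?case unfolding step Suc a(2)
      using a(1) by (subst ennreal_plus[symmetric]) (auto simp: algebra_simps)
  qed
  then show ?thesis using that a(1) unfolding I_def by blast
qed

section \<open>The Hardy--Littlewood--Sobolev inequality\<close>

text \<open>With \<open>r'\<close> conjugate to \<open>r\<close>, the last hypothesis means that
  \<open>\<mu> * r'\<close> exceeds the dimension, so that away from its singularity the kernel lies
  in the dual of the space of \<open>h\<close>. The quantifiers stand inside the formula to let one
  \<open>C\<close> serve all \<open>h\<close>, \<open>\<tau>\<close> and \<open>x\<close>.\<close>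

lemma nn_integral_Riesz_kernel_truncated:
  fixes \<mu> r :: real
  assumes r: "1 < r" and \<mu>: "0 < \<mu>" "\<mu> < real DIM('a::euclidean_space)" "real DIM('a) * (1 - 1 / r) < \<mu>"
  shows "\<exists>C>0. \<forall>(h :: 'a \<Rightarrow> real) \<tau> x. h \<in> borel_measurable borel \<longrightarrow> (\<forall>y. 0 \<le> h y) \<longrightarrow>
        (\<integral>\<^sup>+y. ennreal (h y powr r) \<partial>lborel) \<le> 1 \<longrightarrow> 0 < \<tau> \<longrightarrow>
        (\<integral>\<^sup>+y. ennreal (h y * norm (x - y) powr - \<mu>) * indicator {y. h y \<le> \<tau>} y \<partial>lborel)
         \<le> ennreal (C * \<tau> powr (1 - r * (1 - \<mu> / real DIM('a))))"
proof -
  let ?n = "real DIM('a)"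
  define r' where "r' = r / (r - 1)"
  have r': "1 < r'" "1 / r + 1 / r' = 1" using r by (auto simp: r'_def field_simps)
  have \<nu>: "?n < \<mu> * r'"
  proof -
    have "1 / r' = 1 - 1 / r" using r'(2) by simp
    then have "?n * (1 / r') < \<mu>" using \<mu>(3) by simp
    then show ?thesis using r'(1) by (simp add: field_simps)
  qed
  obtain C1 where C1: "0 < C1"
    "\<And>\<rho>. 0 < \<rho> \<Longrightarrow> (\<integral>\<^sup>+x. ennreal (norm (x::'a) powr - \<mu>) * indicator {x. norm x < \<rho>} x \<partial>lborel)
        \<le> ennreal (C1 * \<rho> powr (?n - \<mu>))"
    by (rule nn_integral_norm_powr_ball[OF less_imp_le[OF \<mu>(1)] \<mu>(2)]) (rule that)
  obtain C2 where C2: "0 < C2"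
    "\<And>\<rho>. 0 < \<rho> \<Longrightarrow> (\<integral>\<^sup>+x. ennreal (norm (x::'a) powr - (\<mu> * r')) * indicator {x. \<rho> \<le> norm x} x \<partial>lborel)
        \<le> ennreal (C2 * \<rho> powr (?n - \<mu> * r'))"
    by (rule nn_integral_norm_powr_outside_ball[OF \<nu>]) (rule that)
  show ?thesis
  proof (intro exI[of _ "C1 + C2 powr (1 / r')"] conjI allI impI)
    show "0 < C1 + C2 powr (1 / r')" using C1 by (simp add: add_pos_nonneg)
    fix h :: "'a \<Rightarrow> real" and \<tau> :: real and x :: 'a
    assume h[measurable]: "h \<in> borel_measurable borel" and h0: "\<forall>y. 0 \<le> h y"
      and hr: "(\<integral>\<^sup>+y. ennreal (h y powr r) \<partial>lborel) \<le> 1" and \<tau>: "0 < \<tau>"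
    \<comment> \<open>the radius at which the near and the far part are of the same size\<close>
    define \<rho> where "\<rho> = \<tau> powr (- r / ?n)"
    have \<rho>: "0 < \<rho>" using \<tau> by (simp add: \<rho>_def)
    define e where "e = 1 - r * (1 - \<mu> / ?n)"
    define near where "near y = ennreal (norm (y::'a) powr - \<mu>) * indicator {y. norm y < \<rho>} y" for y
    define far where "far y = ennreal (norm (y::'a) powr - \<mu>) * indicator {y. \<rho> \<le> norm y} y" for y
    have [measurable]: "near \<in> borel_measurable borel" "far \<in> borel_measurable borel"
      unfolding near_def far_def by measurable
    have "(\<integral>\<^sup>+y. ennreal (h y * norm (x - y) powr - \<mu>) * indicator {y. h y \<le> \<tau>} y \<partial>lborel)
       \<le> (\<integral>\<^sup>+y. ennreal \<tau> * near (x - y) + ennreal (h y) * far (x - y) \<partial>lborel)"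
    proof (rule nn_integral_mono)
      fix y
      have "ennreal (h y * norm (x - y) powr - \<mu>) \<le> ennreal \<tau> * ennreal (norm (x - y) powr - \<mu>)" if "h y \<le> \<tau>"
        using that \<tau> h0 by (simp add: ennreal_mult[symmetric] mult_right_mono ennreal_leI)
      then show "ennreal (h y * norm (x - y) powr - \<mu>) * indicator {y. h y \<le> \<tau>} y
          \<le> ennreal \<tau> * near (x - y) + ennreal (h y) * far (x - y)"
        using h0 by (auto simp: near_def far_def indicator_def ennreal_mult)
    qed
    also have "\<dots> = ennreal \<tau> * (\<integral>\<^sup>+y. near (x - y) \<partial>lborel) + (\<integral>\<^sup>+y. ennreal (h y) * far (x - y) \<partial>lborel)"
      by (subst nn_integral_add) (auto simp: nn_integral_cmult)
    also have "\<dots> \<le> ennreal (C1 * \<tau> powr e) + ennreal (C2 powr (1 / r') * \<tau> powr e)"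
    proof (intro add_mono)
      have "ennreal \<tau> * (\<integral>\<^sup>+y. near (x - y) \<partial>lborel) \<le> ennreal \<tau> * ennreal (C1 * \<rho> powr (?n - \<mu>))"
        using C1(2)[OF \<rho>] unfolding nn_integral_lborel_diff[OF \<open>near \<in> _\<close>]
        by (intro mult_left_mono) (auto simp: near_def[abs_def])
      also have "\<dots> = ennreal (C1 * (\<tau> powr 1 * \<rho> powr (?n - \<mu>)))"
        using \<tau> C1 by (simp add: ennreal_mult[symmetric] mult_ac)
      also have "\<tau> powr 1 * \<rho> powr (?n - \<mu>) = \<tau> powr e"
        unfolding \<rho>_def powr_powr powr_add[symmetric] by (simp add: e_def field_simps)
      finally show "ennreal \<tau> * (\<integral>\<^sup>+y. near (x - y) \<partial>lborel) \<le> ennreal (C1 * \<tau> powr e)" .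
    next
      \<comment> \<open>A bound for the norm of the far kernel in the dual space; by the choice of
        \<open>\<rho>\<close> it is a multiple of \<open>\<tau> powr e\<close>, like the near
        part.\<close>
      define b where "b = (C2 * \<rho> powr (?n - \<mu> * r')) powr (1 / r')"
      have "b powr r' = C2 * \<rho> powr (?n - \<mu> * r')"
        using C2(1) r'(1) \<rho> by (simp add: b_def powr_powr)
      moreover have "(\<integral>\<^sup>+y. ennpowr (far (x - y)) r' \<partial>lborel) = (\<integral>\<^sup>+y. ennpowr (far y) r' \<partial>lborel)"
        by (rule nn_integral_lborel_diff) simp
      moreover have "\<dots> = (\<integral>\<^sup>+x. ennreal (norm (x::'a) powr - (\<mu> * r')) * indicator {x. \<rho> \<le> norm x} x \<partial>lborel)"
        by (intro nn_integral_cong) (auto simp: far_def indicator_def powr_powr)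
      ultimately have far: "(\<integral>\<^sup>+y. ennpowr (far (x - y)) r' \<partial>lborel) \<le> ennreal (b powr r')"
        using C2(2)[OF \<rho>] by simp
      have "(\<integral>\<^sup>+y. ennreal (h y) * far (x - y) \<partial>lborel) \<le> ennreal (1 * b)"
        by (rule Holder_nn_integral_bound[OF _ _ r r'(1,2) _ _ _ far])
           (use hr h0 C2(1) \<rho> in \<open>auto simp: b_def\<close>)
      also have "1 * b = C2 powr (1 / r') * \<tau> powr e"
      proof -
        have inv: "1 / r' = 1 - 1 / r" using r'(2) by simp
        have "(- r / ?n) * ((?n - \<mu> * r') * (1 / r')) = - r * (1 / r') + r * \<mu> / ?n"
          using r'(1) by (simp add: field_simps)
        also have "\<dots> = - r * (1 - 1 / r) + r * \<mu> / ?n" using inv by (simp only:)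
        also have "\<dots> = e" using r by (simp add: e_def field_simps)
        finally have e: "(- r / ?n) * ((?n - \<mu> * r') * (1 / r')) = e" .
        have "b = C2 powr (1 / r') * (\<rho> powr (?n - \<mu> * r')) powr (1 / r')"
          using C2(1) by (simp add: b_def powr_mult)
        also have "(\<rho> powr (?n - \<mu> * r')) powr (1 / r') = \<tau> powr e"
          unfolding \<rho>_def powr_powr using e by (simp only: mult.assoc)
        finally show ?thesis by simp
      qed
      finally show "(\<integral>\<^sup>+y. ennreal (h y) * far (x - y) \<partial>lborel) \<le> ennreal (C2 powr (1 / r') * \<tau> powr e)" .
    qed
    also have "\<dots> = ennreal ((C1 + C2 powr (1 / r')) * \<tau> powr e)"
      using C1(1) by (subst ennreal_plus[symmetric]) (auto simp: algebra_simps)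
    finally show "(\<integral>\<^sup>+y. ennreal (h y * norm (x - y) powr - \<mu>) * indicator {y. h y \<le> \<tau>} y \<partial>lborel)
       \<le> ennreal ((C1 + C2 powr (1 / r')) * \<tau> powr (1 - r * (1 - \<mu> / ?n)))"
      by (simp add: e_def)
  qed
qed

text \<open>On the region kept by the indicator, \<open>h y\<close> is at most
  \<open>\<psi> x powr (p / r)\<close>. This level depends on \<open>x\<close> alone, so the
  truncated estimate applies to the inner integral. The scaling relation turns the outcome into a
  multiple of \<open>\<psi> x powr p\<close>, whose integral is at most \<open>1\<close>.\<close>

lemma Hardy_Littlewood_Sobolev_half:
  fixes \<mu> p r :: real
  assumes p: "1 < p" and r: "1 < r" and \<mu>: "0 < \<mu>" "\<mu> < real DIM('a::euclidean_space)"
    and sum: "1 / p + 1 / r + \<mu> / real DIM('a) = 2"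
  shows "\<exists>C>0. \<forall>\<psi> h :: 'a \<Rightarrow> real. \<psi> \<in> borel_measurable borel \<longrightarrow> h \<in> borel_measurable borel \<longrightarrow>
       (\<forall>x. 0 \<le> \<psi> x) \<longrightarrow> (\<forall>x. 0 \<le> h x) \<longrightarrow>
       (\<integral>\<^sup>+x. ennreal (\<psi> x powr p) \<partial>lborel) \<le> 1 \<longrightarrow> (\<integral>\<^sup>+x. ennreal (h x powr r) \<partial>lborel) \<le> 1 \<longrightarrow>
       (\<integral>\<^sup>+x. \<integral>\<^sup>+y. ennreal (\<psi> x * h y * norm (x - y) powr - \<mu>)
            * indicator {y. h y powr r \<le> \<psi> x powr p} y \<partial>lborel \<partial>lborel) \<le> ennreal C"
proof -
  let ?n = "real DIM('a)"
  have \<theta>: "1 - \<mu> / ?n = 1 / p + 1 / r - 1" using sum by simp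
  \<comment> \<open>Since \<open>1 / p < 1\<close>, the scaling relation leaves room for the
    hypothesis of the truncated estimate.\<close>
  have "1 - 1 / r < \<mu> / ?n" using sum p by (smt (verit) divide_less_eq_1_pos)
  then have \<mu>': "?n * (1 - 1 / r) < \<mu>" by (simp add: field_simps)
  obtain C where C: "0 < C"
    "\<forall>(h :: 'a \<Rightarrow> real) \<tau> x. h \<in> borel_measurable borel \<longrightarrow> (\<forall>y. 0 \<le> h y) \<longrightarrow>
        (\<integral>\<^sup>+y. ennreal (h y powr r) \<partial>lborel) \<le> 1 \<longrightarrow> 0 < \<tau> \<longrightarrow>
        (\<integral>\<^sup>+y. ennreal (h y * norm (x - y) powr - \<mu>) * indicator {y. h y \<le> \<tau>} y \<partial>lborel)
         \<le> ennreal (C * \<tau> powr (1 - r * (1 - \<mu> / ?n)))"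
    using nn_integral_Riesz_kernel_truncated[OF r \<mu> \<mu>'] by (elim exE conjE) (rule that)
  show ?thesis
  proof (intro exI[of _ C] conjI allI impI C(1))
    fix \<psi> h :: "'a \<Rightarrow> real"
    assume [measurable]: "\<psi> \<in> borel_measurable borel" "h \<in> borel_measurable borel"
      and \<psi>0: "\<forall>x. 0 \<le> \<psi> x" and h0: "\<forall>x. 0 \<le> h x"
      and \<psi>p: "(\<integral>\<^sup>+x. ennreal (\<psi> x powr p) \<partial>lborel) \<le> 1" and hr: "(\<integral>\<^sup>+x. ennreal (h x powr r) \<partial>lborel) \<le> 1"
    have "(\<integral>\<^sup>+x. \<integral>\<^sup>+y. ennreal (\<psi> x * h y * norm (x - y) powr - \<mu>)
            * indicator {y. h y powr r \<le> \<psi> x powr p} y \<partial>lborel \<partial>lborel)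
        \<le> (\<integral>\<^sup>+x. ennreal C * ennreal (\<psi> x powr p) \<partial>lborel)"
    proof (rule nn_integral_mono)
      fix x
      show "(\<integral>\<^sup>+y. ennreal (\<psi> x * h y * norm (x - y) powr - \<mu>)
            * indicator {y. h y powr r \<le> \<psi> x powr p} y \<partial>lborel) \<le> ennreal C * ennreal (\<psi> x powr p)"
      proof (cases "\<psi> x = 0")
        case False
        then have pos: "0 < \<psi> x" using \<psi>0[rule_format, of x] by simp
        define \<tau> where "\<tau> = \<psi> x powr (p / r)"
        have \<tau>: "0 < \<tau>" "\<tau> powr r = \<psi> x powr p" using pos r by (auto simp: \<tau>_def powr_powr)
        have le_iff: "h y powr r \<le> \<psi> x powr p \<longleftrightarrow> h y \<le> \<tau>" for y
          using powr_less_mono2[of r \<tau> "h y"] powr_mono2[of r "h y" \<tau>] \<tau> h0[rule_format, of y] r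
          by (cases "h y \<le> \<tau>") auto
        have "(\<integral>\<^sup>+y. ennreal (\<psi> x * h y * norm (x - y) powr - \<mu>)
            * indicator {y. h y powr r \<le> \<psi> x powr p} y \<partial>lborel)
          = (\<integral>\<^sup>+y. ennreal (\<psi> x) * (ennreal (h y * norm (x - y) powr - \<mu>) * indicator {y. h y \<le> \<tau>} y) \<partial>lborel)"
          unfolding le_iff using \<psi>0 h0
          by (intro nn_integral_cong) (auto simp: indicator_def ennreal_mult[symmetric] mult_ac)
        also have "\<dots> = ennreal (\<psi> x) * (\<integral>\<^sup>+y. ennreal (h y * norm (x - y) powr - \<mu>) * indicator {y. h y \<le> \<tau>} y \<partial>lborel)"
          by (rule nn_integral_cmult) measurable
        also have "\<dots> \<le> ennreal (\<psi> x) * ennreal (C * \<tau> powr (1 - r * (1 - \<mu> / ?n)))"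
          by (intro mult_left_mono C(2)[rule_format] h0[rule_format] hr \<tau>) auto
        also have "\<dots> = ennreal (C * (\<psi> x powr 1 * \<tau> powr (1 - r * (1 - \<mu> / ?n))))"
          using pos C(1) by (simp add: ennreal_mult[symmetric] mult_ac)
        also have "\<psi> x powr 1 * \<tau> powr (1 - r * (1 - \<mu> / ?n)) = \<psi> x powr (1 + (p / r) * (1 - r * (1 - \<mu> / ?n)))"
          by (simp only: \<tau>_def powr_powr powr_add)
        also have "1 + (p / r) * (1 - r * (1 - \<mu> / ?n)) = p"
          unfolding \<theta> using p r by (simp add: field_simps)
        finally show ?thesis using C(1) by (simp add: ennreal_mult)
      qed simp
    qed
    also have "\<dots> = ennreal C * (\<integral>\<^sup>+x. ennreal (\<psi> x powr p) \<partial>lborel)"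
      by (rule nn_integral_cmult) simp
    also have "\<dots> \<le> ennreal C * 1" by (intro mult_left_mono \<psi>p) auto
    finally show "(\<integral>\<^sup>+x. \<integral>\<^sup>+y. ennreal (\<psi> x * h y * norm (x - y) powr - \<mu>)
            * indicator {y. h y powr r \<le> \<psi> x powr p} y \<partial>lborel \<partial>lborel) \<le> ennreal C" by simp
  qed
qed

text \<open>The region of the half estimate and its mirror image cover all pairs of points.
  Exchanging the two functions, their exponents and the order of integration turns the second region
  into the first. Homogeneity then brings in \<open>a\<close> and \<open>b\<close>.\<close>

theorem Hardy_Littlewood_Sobolev:
  fixes \<mu> p r :: real
  assumes p: "1 < p" and r: "1 < r" and \<mu>: "0 < \<mu>" "\<mu> < real DIM('a::euclidean_space)"
    and sum: "1 / p + 1 / r + \<mu> / real DIM('a) = 2"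
  shows "\<exists>C>0. \<forall>(\<psi> :: 'a \<Rightarrow> real) h a b. \<psi> \<in> borel_measurable borel \<longrightarrow> h \<in> borel_measurable borel \<longrightarrow>
       (\<forall>x. 0 \<le> \<psi> x) \<longrightarrow> (\<forall>x. 0 \<le> h x) \<longrightarrow> 0 < a \<longrightarrow> 0 < b \<longrightarrow>
       (\<integral>\<^sup>+x. ennreal (\<psi> x powr p) \<partial>lborel) \<le> ennreal (a powr p) \<longrightarrow>
       (\<integral>\<^sup>+x. ennreal (h x powr r) \<partial>lborel) \<le> ennreal (b powr r) \<longrightarrow>
       (\<integral>\<^sup>+x. \<integral>\<^sup>+y. ennreal (\<psi> x * h y * norm (x - y) powr - \<mu>) \<partial>lborel \<partial>lborel) \<le> ennreal (C * a * b)"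
proof -
  obtain C1 where C1: "0 < C1"
    "\<forall>\<psi> h :: 'a \<Rightarrow> real. \<psi> \<in> borel_measurable borel \<longrightarrow> h \<in> borel_measurable borel \<longrightarrow>
       (\<forall>x. 0 \<le> \<psi> x) \<longrightarrow> (\<forall>x. 0 \<le> h x) \<longrightarrow>
       (\<integral>\<^sup>+x. ennreal (\<psi> x powr p) \<partial>lborel) \<le> 1 \<longrightarrow> (\<integral>\<^sup>+x. ennreal (h x powr r) \<partial>lborel) \<le> 1 \<longrightarrow>
       (\<integral>\<^sup>+x. \<integral>\<^sup>+y. ennreal (\<psi> x * h y * norm (x - y) powr - \<mu>)
            * indicator {y. h y powr r \<le> \<psi> x powr p} y \<partial>lborel \<partial>lborel) \<le> ennreal C1"
    using Hardy_Littlewood_Sobolev_half[OF p r \<mu> sum] by (elim exE conjE) (rule that)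
  have sum': "1 / r + 1 / p + \<mu> / real DIM('a) = 2" using sum by simp
  obtain C2 where C2: "0 < C2"
    "\<forall>\<psi> h :: 'a \<Rightarrow> real. \<psi> \<in> borel_measurable borel \<longrightarrow> h \<in> borel_measurable borel \<longrightarrow>
       (\<forall>x. 0 \<le> \<psi> x) \<longrightarrow> (\<forall>x. 0 \<le> h x) \<longrightarrow>
       (\<integral>\<^sup>+x. ennreal (\<psi> x powr r) \<partial>lborel) \<le> 1 \<longrightarrow> (\<integral>\<^sup>+x. ennreal (h x powr p) \<partial>lborel) \<le> 1 \<longrightarrow>
       (\<integral>\<^sup>+x. \<integral>\<^sup>+y. ennreal (\<psi> x * h y * norm (x - y) powr - \<mu>)
            * indicator {y. h y powr p \<le> \<psi> x powr r} y \<partial>lborel \<partial>lborel) \<le> ennreal C2"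
    using Hardy_Littlewood_Sobolev_half[OF r p \<mu> sum'] by (elim exE conjE) (rule that)
  have normalised: "(\<integral>\<^sup>+x. \<integral>\<^sup>+y. ennreal (\<psi> x * h y * norm (x - y) powr - \<mu>) \<partial>lborel \<partial>lborel) \<le> ennreal (C1 + C2)"
    if [measurable]: "\<psi> \<in> borel_measurable borel" "h \<in> borel_measurable borel"
      and \<psi>0: "\<And>x. 0 \<le> \<psi> x" and h0: "\<And>x. 0 \<le> h x"
      and \<psi>p: "(\<integral>\<^sup>+x. ennreal (\<psi> x powr p) \<partial>lborel) \<le> 1" and hr: "(\<integral>\<^sup>+x. ennreal (h x powr r) \<partial>lborel) \<le> 1"
    for \<psi> h :: "'a \<Rightarrow> real"
  proof -
    define K1 where "K1 x y = ennreal (\<psi> x * h y * norm (x - y) powr - \<mu>)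
            * indicator {y. h y powr r \<le> \<psi> x powr p} y" for x y
    define K2 where "K2 x y = ennreal (h y * \<psi> x * norm (y - x) powr - \<mu>)
            * indicator {x. \<psi> x powr p \<le> h y powr r} x" for x y
    \<comment> \<open>The indicator sets depend on the other variable; written as conditionals, the
      two kernels are visibly measurable in both variables jointly.\<close>
    have K1_eq: "K1 x y = ennreal (\<psi> x * h y * norm (x - y) powr - \<mu>) * (if h y powr r \<le> \<psi> x powr p then 1 else 0)" for x y
      by (simp add: K1_def)
    have K2_eq: "K2 x y = ennreal (h y * \<psi> x * norm (y - x) powr - \<mu>) * (if \<psi> x powr p \<le> h y powr r then 1 else 0)" for x y
      by (simp add: K2_def)
    have [measurable]: "case_prod K1 \<in> borel_measurable (borel \<Otimes>\<^sub>M borel)" "case_prod K2 \<in> borel_measurable (borel \<Otimes>\<^sub>M borel)"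
      unfolding K1_eq[abs_def] K2_eq[abs_def] by measurable
    have "(\<integral>\<^sup>+x. \<integral>\<^sup>+y. ennreal (\<psi> x * h y * norm (x - y) powr - \<mu>) \<partial>lborel \<partial>lborel)
      \<le> (\<integral>\<^sup>+x. \<integral>\<^sup>+y. K1 x y + K2 x y \<partial>lborel \<partial>lborel)"
      by (intro nn_integral_mono) (auto simp: K1_def K2_def indicator_def norm_minus_commute mult_ac)
    also have "\<dots> = (\<integral>\<^sup>+x. \<integral>\<^sup>+y. K1 x y \<partial>lborel \<partial>lborel) + (\<integral>\<^sup>+x. \<integral>\<^sup>+y. K2 x y \<partial>lborel \<partial>lborel)"
      by (simp add: nn_integral_add)
    also have "(\<integral>\<^sup>+x. \<integral>\<^sup>+y. K2 x y \<partial>lborel \<partial>lborel) = (\<integral>\<^sup>+y. \<integral>\<^sup>+x. K2 x y \<partial>lborel \<partial>lborel)"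
      by (rule lborel_pair.Fubini') simp
    also have "(\<integral>\<^sup>+x. \<integral>\<^sup>+y. K1 x y \<partial>lborel \<partial>lborel) + (\<integral>\<^sup>+y. \<integral>\<^sup>+x. K2 x y \<partial>lborel \<partial>lborel) \<le> ennreal C1 + ennreal C2"
      unfolding K1_def K2_def by (intro add_mono C1(2)[rule_format] C2(2)[rule_format] that)
    finally show ?thesis using C1(1) C2(1) by simp
  qed
  show ?thesis
  proof (intro exI[of _ "C1 + C2"] conjI allI impI)
    show "0 < C1 + C2" using C1 C2 by simp
    fix \<psi> h :: "'a \<Rightarrow> real" and a b :: real
    assume [measurable]: "\<psi> \<in> borel_measurable borel" "h \<in> borel_measurable borel"
      and \<psi>0: "\<forall>x. 0 \<le> \<psi> x" and h0: "\<forall>x. 0 \<le> h x" and ab: "0 < a" "0 < b"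
      and \<psi>p: "(\<integral>\<^sup>+x. ennreal (\<psi> x powr p) \<partial>lborel) \<le> ennreal (a powr p)"
      and hr: "(\<integral>\<^sup>+x. ennreal (h x powr r) \<partial>lborel) \<le> ennreal (b powr r)"
    have scale: "(\<integral>\<^sup>+x. ennreal ((g x / c) powr s) \<partial>lborel) \<le> 1"
      if [measurable]: "g \<in> borel_measurable borel" and g: "\<And>x. 0 \<le> g x" "0 < c"
        "(\<integral>\<^sup>+x. ennreal (g x powr s) \<partial>lborel) \<le> ennreal (c powr s)" for g :: "'a \<Rightarrow> real" and c s
    proof -
      have "(\<integral>\<^sup>+x. ennreal ((g x / c) powr s) \<partial>lborel) = (\<integral>\<^sup>+x. ennreal (1 / c powr s) * ennreal (g x powr s) \<partial>lborel)"
        using g by (intro nn_integral_cong) (auto simp: powr_divide ennreal_mult[symmetric])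
      also have "\<dots> = ennreal (1 / c powr s) * (\<integral>\<^sup>+x. ennreal (g x powr s) \<partial>lborel)"
        by (rule nn_integral_cmult) simp
      also have "\<dots> \<le> ennreal (1 / c powr s) * ennreal (c powr s)"
        by (intro mult_left_mono g) auto
      also have "\<dots> = 1" using g(2) by (simp add: ennreal_mult[symmetric])
      finally show ?thesis .
    qed
    have "(\<integral>\<^sup>+x. \<integral>\<^sup>+y. ennreal (\<psi> x * h y * norm (x - y) powr - \<mu>) \<partial>lborel \<partial>lborel)
      = (\<integral>\<^sup>+x. \<integral>\<^sup>+y. ennreal (a * b) * ennreal ((\<psi> x / a) * (h y / b) * norm (x - y) powr - \<mu>) \<partial>lborel \<partial>lborel)"
      using \<psi>0 h0 ab by (intro nn_integral_cong) (auto simp: ennreal_mult[symmetric])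
    also have "\<dots> = ennreal (a * b) * (\<integral>\<^sup>+x. \<integral>\<^sup>+y. ennreal ((\<psi> x / a) * (h y / b) * norm (x - y) powr - \<mu>) \<partial>lborel \<partial>lborel)"
      by (simp add: nn_integral_cmult)
    also have "\<dots> \<le> ennreal (a * b) * ennreal (C1 + C2)"
      by (intro mult_left_mono normalised scale) (use \<psi>0 h0 ab \<psi>p hr in auto)
    also have "\<dots> = ennreal ((C1 + C2) * a * b)"
      using ab C1(1) C2(1) by (simp add: ennreal_mult[symmetric] mult_ac del: ennreal_plus)
    finally show "(\<integral>\<^sup>+x. \<integral>\<^sup>+y. ennreal (\<psi> x * h y * norm (x - y) powr - \<mu>) \<partial>lborel \<partial>lborel) \<le> ennreal ((C1 + C2) * a * b)" .
  qed
qed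

section \<open>Boundedness of the positive operator\<close>

text \<open>\<open>a1\<close> stands for \<open>1 / p1\<close> and is \<open>0\<close> for infinite
  \<open>p1\<close>; thus \<open>s\<close> is conjugate to \<open>p1\<close>, and \<open>q'\<close>
  to \<open>q\<close>. In the application \<open>G\<close> is the inner norm and
  \<open>\<phi>\<close> the dual function.\<close>

lemma Holder_Riesz_potential:
  fixes a1 p2 q l :: real
  assumes a1: "0 \<le> a1" and p2: "1 < p2" and pq: "p2 < q" and qp: "a1 * q < 1"
    and l: "0 < l" "l < real DIM('a::euclidean_space)"
    and sum: "a1 + 1 / p2 = 1 / q + (real DIM('a) - l) / real DIM('a)"
  defines "s \<equiv> 1 / (1 - a1)" and "q' \<equiv> q / (q - 1)"
  shows "\<exists>C>0. \<forall>(G :: 'a \<Rightarrow> real) \<phi> m b. G \<in> borel_measurable borel \<longrightarrow> \<phi> \<in> borel_measurable borel \<longrightarrow>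
     (\<forall>x. 0 \<le> G x) \<longrightarrow> (\<forall>x. 0 \<le> \<phi> x) \<longrightarrow> 0 < m \<longrightarrow> 0 < b \<longrightarrow>
     (\<integral>\<^sup>+x. ennreal (G x powr p2) \<partial>lborel) \<le> ennreal (m powr p2) \<longrightarrow>
     (\<integral>\<^sup>+x. ennreal (\<phi> x powr q') \<partial>lborel) \<le> ennreal (b powr q') \<longrightarrow>
     (\<integral>\<^sup>+y. ennreal (G y) * ennpowr (\<integral>\<^sup>+v. ennreal ((norm (y - v) powr - l * \<phi> v) powr s) \<partial>lborel) (1 / s) \<partial>lborel)
       \<le> ennreal (C * m * b)"
proof -
  let ?n = "real DIM('a)"
  have n: "0 < ?n" by simp
  have q: "1 < q" using p2 pq by simp
  have a1q: "a1 < 1 / q" using qp q by (simp add: field_simps)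
  have qinv: "1 / q < 1 / p2" "1 / q < 1" "1 / p2 < 1" "0 < 1 / q" "0 < 1 / p2"
    using p2 pq q by (auto simp: field_simps)
  have a1_less: "a1 < 1" using a1q qinv by linarith
  have s: "1 \<le> s" "1 / s = 1 - a1" using a1 a1_less by (auto simp: s_def field_simps)
  have inv_q': "1 / q' = 1 - 1 / q" and q'0: "1 < q'" using q by (auto simp: q'_def field_simps)
  \<comment> \<open>The power of \<open>G\<close> that enters the bilinear form: Hoelder's
    inequality raises the second factor of \<open>G\<close>, with exponent
    \<open>1 - p2 * a1\<close>, to the power \<open>s\<close>.\<close>
  define \<gamma> where "\<gamma> = s * (1 - p2 * a1)"
  define \<mu> where "\<mu> = l * s"
  have "p2 * a1 < 1"
  proof -
    have "a1 < 1 / p2" using a1q qinv by linarith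
    then show ?thesis using p2 by (simp add: field_simps)
  qed
  then have \<gamma>: "0 < \<gamma>" using s by (simp add: \<gamma>_def)
  have \<gamma>s: "\<gamma> / s = 1 - p2 * a1" using s by (simp add: \<gamma>_def)
  \<comment> \<open>This expresses \<open>q < p1\<close>: the reciprocal \<open>1 - 1 / q\<close> of
    \<open>q'\<close> lies below the reciprocal \<open>1 - a1\<close> of \<open>s\<close>.\<close>
  have P: "1 < q' / s"
  proof -
    have "1 / q' < 1 / s" using a1q inv_q' s by simp
    then have "s < q'" using s(1) q'0 by (simp add: field_simps)
    then show ?thesis using s by (simp add: field_simps)
  qed
  \<comment> \<open>This expresses \<open>1 < p2\<close>, since
    \<open>(1 - a1) * (p2 - \<gamma>) = p2 - 1\<close>.\<close>
  have R: "1 < p2 / \<gamma>"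
  proof -
    have "0 < (1 - a1) * (p2 - \<gamma>)"
    proof -
      have "(1 - a1) * \<gamma> = 1 - p2 * a1" using \<gamma>s s by (simp add: \<gamma>_def s_def)
      then have "(1 - a1) * (p2 - \<gamma>) = p2 - 1" by (simp add: algebra_simps)
      then show ?thesis using p2 by simp
    qed
    then have "\<gamma> < p2" using a1_less by (simp add: zero_less_mult_iff)
    then show ?thesis using \<gamma> by simp
  qed
  have ln: "l / ?n = 1 + 1 / q - a1 - 1 / p2"
    using sum n by (simp add: diff_divide_distrib)
  \<comment> \<open>The upper bound expresses \<open>p2 < q\<close>: by the scaling relation
    \<open>l / ?n\<close> falls short of \<open>1 / s\<close> by
    \<open>1 / p2 - 1 / q\<close>.\<close>
  have \<mu>: "0 < \<mu>" "\<mu> < ?n"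
  proof -
    show "0 < \<mu>" using l s by (simp add: \<mu>_def)
    have "l / ?n < 1 / s" using ln qinv s by linarith
    then show "\<mu> < ?n" using s(1) n by (simp add: \<mu>_def field_simps)
  qed
  have HLS_sum: "1 / (q' / s) + 1 / (p2 / \<gamma>) + \<mu> / ?n = 2"
  proof -
    have "1 / (q' / s) + 1 / (p2 / \<gamma>) + \<mu> / ?n = s * (1 / q' + (1 - p2 * a1) / p2 + l / ?n)"
      by (simp add: \<gamma>_def \<mu>_def algebra_simps)
    also have "(1 - p2 * a1) / p2 = 1 / p2 - a1" using p2 by (simp add: field_simps)
    also have "1 / q' + (1 / p2 - a1) + l / ?n = 2 * (1 / s)"
      unfolding inv_q' ln s(2) by simp
    finally show ?thesis using s(1) by simp
  qed
  obtain C where C: "0 < C"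
    "\<forall>(\<psi> :: 'a \<Rightarrow> real) h a b. \<psi> \<in> borel_measurable borel \<longrightarrow> h \<in> borel_measurable borel \<longrightarrow>
       (\<forall>x. 0 \<le> \<psi> x) \<longrightarrow> (\<forall>x. 0 \<le> h x) \<longrightarrow> 0 < a \<longrightarrow> 0 < b \<longrightarrow>
       (\<integral>\<^sup>+x. ennreal (\<psi> x powr (q' / s)) \<partial>lborel) \<le> ennreal (a powr (q' / s)) \<longrightarrow>
       (\<integral>\<^sup>+x. ennreal (h x powr (p2 / \<gamma>)) \<partial>lborel) \<le> ennreal (b powr (p2 / \<gamma>)) \<longrightarrow>
       (\<integral>\<^sup>+x. \<integral>\<^sup>+y. ennreal (\<psi> x * h y * norm (x - y) powr - \<mu>) \<partial>lborel \<partial>lborel) \<le> ennreal (C * a * b)"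
    using Hardy_Littlewood_Sobolev[OF P R \<mu> HLS_sum] by (elim exE conjE) (rule that)
  show ?thesis
  proof (intro exI[of _ "C powr (1 / s)"] conjI allI impI)
    show "0 < C powr (1 / s)" using C by simp
    fix G \<phi> :: "'a \<Rightarrow> real" and m b :: real
    assume [measurable]: "G \<in> borel_measurable borel" "\<phi> \<in> borel_measurable borel"
      and G0: "\<forall>x. 0 \<le> G x" and \<phi>0: "\<forall>x. 0 \<le> \<phi> x" and mb: "0 < m" "0 < b"
      and G: "(\<integral>\<^sup>+x. ennreal (G x powr p2) \<partial>lborel) \<le> ennreal (m powr p2)"
      and \<phi>: "(\<integral>\<^sup>+x. ennreal (\<phi> x powr q') \<partial>lborel) \<le> ennreal (b powr q')"
    define I where "I y = (\<integral>\<^sup>+v. ennreal ((norm (y - v) powr - l * \<phi> v) powr s) \<partial>lborel)" for y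
    have [measurable]: "I \<in> borel_measurable borel" unfolding I_def by measurable
    have HLS: "(\<integral>\<^sup>+y. ennreal (G y powr \<gamma>) * I y \<partial>lborel) \<le> ennreal (C * b powr s * m powr \<gamma>)"
    proof -
      have "(\<integral>\<^sup>+y. ennreal (G y powr \<gamma>) * I y \<partial>lborel)
        = (\<integral>\<^sup>+y. \<integral>\<^sup>+v. ennreal (\<phi> v powr s * G y powr \<gamma> * norm (v - y) powr - \<mu>) \<partial>lborel \<partial>lborel)"
      proof (rule nn_integral_cong)
        fix y
        have "ennreal (G y powr \<gamma>) * I y = (\<integral>\<^sup>+v. ennreal (G y powr \<gamma>) * ennreal ((norm (y - v) powr - l * \<phi> v) powr s) \<partial>lborel)"
          unfolding I_def by (rule nn_integral_cmult[symmetric]) simp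
        also have "\<dots> = (\<integral>\<^sup>+v. ennreal (\<phi> v powr s * G y powr \<gamma> * norm (v - y) powr - \<mu>) \<partial>lborel)"
          using \<phi>0 by (intro nn_integral_cong)
            (simp add: ennreal_mult[symmetric] powr_mult powr_powr \<mu>_def norm_minus_commute mult_ac)
        finally show "ennreal (G y powr \<gamma>) * I y
          = (\<integral>\<^sup>+v. ennreal (\<phi> v powr s * G y powr \<gamma> * norm (v - y) powr - \<mu>) \<partial>lborel)" .
      qed
      also have "\<dots> = (\<integral>\<^sup>+v. \<integral>\<^sup>+y. ennreal (\<phi> v powr s * G y powr \<gamma> * norm (v - y) powr - \<mu>) \<partial>lborel \<partial>lborel)"
        by (rule lborel_pair.Fubini') simp
      also have "\<dots> \<le> ennreal (C * b powr s * m powr \<gamma>)"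
        by (rule C(2)[rule_format]) (use G0 \<phi>0 mb G \<phi> s \<gamma> in \<open>simp_all add: powr_powr\<close>)
      finally show ?thesis .
    qed
    show "(\<integral>\<^sup>+y. ennreal (G y) * ennpowr (\<integral>\<^sup>+v. ennreal ((norm (y - v) powr - l * \<phi> v) powr s) \<partial>lborel) (1 / s) \<partial>lborel)
       \<le> ennreal (C powr (1 / s) * m * b)"
    \<comment> \<open>For infinite \<open>p1\<close> both \<open>s\<close> and
      \<open>\<gamma>\<close> are \<open>1\<close>, and the form just bounded is the claim
      itself.\<close>
    proof (cases "a1 = 0")
      case True
      then have [simp]: "s = 1" "\<gamma> = 1" by (simp_all add: s_def \<gamma>_def)
      show ?thesis using HLS C mb G0 by (simp add: I_def mult_ac)
    next
      case False
      \<comment> \<open>Hoelder's inequality for \<open>G = G\<^bsup>p2/p1\<^esup> G\<^bsup>1 - p2/p1\<^esup>\<close>\<close>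
      define p1 where "p1 = 1 / a1"
      have p1: "1 < p1" "1 < s" "1 / p1 + 1 / s = 1"
        using False a1 a1_less s by (auto simp: p1_def s_def)
      have split: "ennreal (G y) * ennpowr (I y) (1 / s)
          = ennreal (G y powr (p2 * a1)) * (ennreal (G y powr (\<gamma> / s)) * ennpowr (I y) (1 / s))" for y
        using G0 by (simp add: mult.assoc[symmetric] ennreal_mult[symmetric] powr_add[symmetric] \<gamma>s)
      have "(\<integral>\<^sup>+y. ennreal (G y) * ennpowr (I y) (1 / s) \<partial>lborel)
         \<le> ennreal (m powr (p2 * a1) * (C * b powr s * m powr \<gamma>) powr (1 / s))"
        unfolding split
      proof (rule Holder_nn_integral_bound[OF _ _ p1])
        show "(\<integral>\<^sup>+y. ennpowr (ennreal (G y powr (p2 * a1))) p1 \<partial>lborel) \<le> ennreal ((m powr (p2 * a1)) powr p1)"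
          using G False by (simp add: powr_powr p1_def)
        show "(\<integral>\<^sup>+y. ennpowr (ennreal (G y powr (\<gamma> / s)) * ennpowr (I y) (1 / s)) s \<partial>lborel)
           \<le> ennreal (((C * b powr s * m powr \<gamma>) powr (1 / s)) powr s)"
          using HLS s(1) C(1) by (simp add: ennpowr_mult powr_powr)
      qed (use mb C in auto)
      also have "m powr (p2 * a1) * (C * b powr s * m powr \<gamma>) powr (1 / s)
         = C powr (1 / s) * b * (m powr (p2 * a1) * m powr (\<gamma> / s))"
        using C(1) mb s(1) by (simp add: powr_mult powr_powr)
      also have "m powr (p2 * a1) * m powr (\<gamma> / s) = m"
        using mb by (simp add: powr_add[symmetric] \<gamma>s)
      finally show ?thesis by (simp add: I_def mult_ac)
    qed
  qed
qed

text \<open>Testing with \<open>t k x powr (q - 1)\<close> gives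
  \<open>A \<le> K * A powr (1 - 1 / q)\<close>, where \<open>A\<close> is the integral of
  \<open>t k x powr q\<close>. Solving for \<open>A\<close> requires that it be finite, which is why
  \<open>T\<close> is truncated first.\<close>

lemma nn_integral_ennpowr_le_of_duality:
  fixes T :: "'a::euclidean_space \<Rightarrow> ennreal" and q K :: real
  assumes [measurable]: "T \<in> borel_measurable borel" and q: "1 < q" and K: "0 < K"
    and dual: "\<And>(\<phi> :: 'a \<Rightarrow> real) b. \<phi> \<in> borel_measurable borel \<Longrightarrow> \<forall>x. 0 \<le> \<phi> x \<Longrightarrow> 0 < b \<Longrightarrow>
       (\<integral>\<^sup>+x. ennreal (\<phi> x powr (q / (q - 1))) \<partial>lborel) \<le> ennreal (b powr (q / (q - 1))) \<Longrightarrow>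
       (\<integral>\<^sup>+x. T x * ennreal (\<phi> x) \<partial>lborel) \<le> ennreal (K * b)"
  shows "(\<integral>\<^sup>+x. ennpowr (T x) q \<partial>lborel) \<le> ennreal (K powr q)"
proof -
  \<comment> \<open>Cut off in height and in space, hence bounded with bounded support, and
    increasing to \<open>T\<close> with \<open>k\<close>.\<close>
  define t where "t k x = enn2real (min (T x) (of_nat k)) * indicator (ball 0 (real k)) x" for k :: nat and x
  have [measurable]: "ball (0::'a) (real k) \<in> sets borel" for k by simp
  have [measurable]: "t k \<in> borel_measurable borel" for k unfolding t_def by measurable
  have t0: "0 \<le> t k x" for k x by (simp add: t_def)
  have t_le: "ennreal (t k x) \<le> T x" for k x
  proof -
    have "min (T x) (of_nat k) < top" by (simp add: min_less_iff_disj of_nat_less_top)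
    then have "ennreal (enn2real (min (T x) (of_nat k))) \<le> T x" by simp
    then show ?thesis by (simp add: t_def indicator_def)
  qed
  have t_mono: "t j x \<le> t k x" if "j \<le> k" for j k x
  proof -
    have "min (T x) (of_nat j) \<le> min (T x) (of_nat k)" using that by (intro min.mono) auto
    then have "enn2real (min (T x) (of_nat j)) \<le> enn2real (min (T x) (of_nat k))"
      by (rule enn2real_mono) (auto simp: min_less_iff_disj of_nat_less_top)
    then show ?thesis using that by (auto simp: t_def indicator_def)
  qed
  have bound: "(\<integral>\<^sup>+x. ennreal (t k x powr q) \<partial>lborel) \<le> ennreal (K powr q)" for k
  proof -
    have "(\<integral>\<^sup>+x. ennreal (t k x powr q) \<partial>lborel) \<le> (\<integral>\<^sup>+x. ennreal (real k powr q) * indicator (ball (0::'a) (real k)) x \<partial>lborel)"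
    proof (rule nn_integral_mono)
      fix x :: 'a
      have "enn2real (min (T x) (of_nat k)) \<le> enn2real (of_nat k)"
        by (rule enn2real_mono) (auto simp: of_nat_less_top)
      then show "ennreal (t k x powr q) \<le> ennreal (real k powr q) * indicator (ball (0::'a) (real k)) x"
        using q by (auto simp: t_def indicator_def intro!: ennreal_leI powr_mono2)
    qed
    also have "\<dots> < top" by (simp add: nn_integral_cmult_indicator emeasure_ball ennreal_mult_less_top)
    finally obtain A where A: "0 \<le> A" "(\<integral>\<^sup>+x. ennreal (t k x powr q) \<partial>lborel) = ennreal A"
      by (cases "\<integral>\<^sup>+x. ennreal (t k x powr q) \<partial>lborel") auto
    show ?thesis
    proof (cases "A = 0")
      case False
      then have A0: "0 < A" using A by simp
      have "ennreal A = (\<integral>\<^sup>+x. ennreal (t k x) * ennreal (t k x powr (q - 1)) \<partial>lborel)"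
        unfolding A(2)[symmetric]
      proof (rule nn_integral_cong)
        fix x
        have "t k x powr q = t k x * t k x powr (q - 1)"
          using t0[of k x] by (cases "t k x = 0") (auto simp: powr_mult_base)
        then show "ennreal (t k x powr q) = ennreal (t k x) * ennreal (t k x powr (q - 1))"
          using t0[of k x] by (simp add: ennreal_mult)
      qed
      also have "\<dots> \<le> (\<integral>\<^sup>+x. T x * ennreal (t k x powr (q - 1)) \<partial>lborel)"
        by (intro nn_integral_mono mult_right_mono t_le) auto
      also have "\<dots> \<le> ennreal (K * A powr (1 - 1 / q))"
      proof (rule dual)
        have e: "(1 - 1 / q) * (q / (q - 1)) = 1" "(q - 1) * (q / (q - 1)) = q"
          using q by (auto simp: field_simps)
        show "(\<integral>\<^sup>+x. ennreal ((t k x powr (q - 1)) powr (q / (q - 1))) \<partial>lborel)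
           \<le> ennreal ((A powr (1 - 1 / q)) powr (q / (q - 1)))"
          unfolding powr_powr e using A A0 by simp
      qed (use A0 in auto)
      finally have "A \<le> K * A powr (1 - 1 / q)" using K by simp
      then have "A powr (1 / q) * A powr (1 - 1 / q) \<le> K * A powr (1 - 1 / q)"
        using A0 by (simp add: powr_add[symmetric])
      then have "A powr (1 / q) \<le> K" using A0 by simp
      then have "(A powr (1 / q)) powr q \<le> K powr q" using q by (intro powr_mono2) auto
      then show ?thesis unfolding A(2) using A0 q by (intro ennreal_leI) (simp add: powr_powr)
    qed (simp add: A)
  qed
  have "(\<integral>\<^sup>+x. ennpowr (T x) q \<partial>lborel) \<le> (\<integral>\<^sup>+x. (SUP k. ennreal (t k x powr q)) \<partial>lborel)"
  proof (rule nn_integral_mono)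
    fix x
    show "ennpowr (T x) q \<le> (SUP k. ennreal (t k x powr q))"
    proof (cases "T x")
      case (real r)
      obtain k :: nat where k: "max r (norm x + 1) \<le> real k" using real_arch_simple by blast
      then have "t k x = r" using real
        by (auto simp: t_def indicator_def min_def ennreal_of_nat_eq_real_of_nat)
      then have "ennpowr (T x) q = ennreal (t k x powr q)" using real by simp
      also have "\<dots> \<le> (SUP k. ennreal (t k x powr q))" by (rule SUP_upper) simp
      finally show ?thesis .
    next
      case top
      obtain N :: nat where N: "norm x + 1 \<le> real N" using real_arch_simple by blast
      \<comment> \<open>Where \<open>T x\<close> is infinite, \<open>t k x = k\<close> for all large
        \<open>k\<close>, and \<open>k \<le> k powr q\<close> makes the supremum infinite.\<close>
      have "(of_nat j :: ennreal) \<le> (SUP k. ennreal (t k x powr q))" for j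
      proof -
        define k where "k = max j N"
        have k: "norm x + 1 \<le> real k" using N by (simp add: k_def)
        then have "t k x = real k" using top by (auto simp: t_def indicator_def ennreal_of_nat_eq_real_of_nat)
        moreover have "1 \<le> real k" using k norm_ge_zero[of x] by linarith
        then have "real k powr 1 \<le> real k powr q" using q by (intro powr_mono) auto
        moreover have "real j \<le> real k" by (simp add: k_def)
        ultimately have "ennreal (real j) \<le> ennreal (t k x powr q)" using \<open>1 \<le> real k\<close> by (intro ennreal_leI) auto
        also have "\<dots> \<le> (SUP k. ennreal (t k x powr q))" by (rule SUP_upper) simp
        finally show ?thesis by (simp add: ennreal_of_nat_eq_real_of_nat)
      qed
      then have "(SUP j. of_nat j :: ennreal) \<le> (SUP k. ennreal (t k x powr q))" by (intro SUP_least)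
      then have "top \<le> (SUP k. ennreal (t k x powr q))" by (simp only: ennreal_SUP_of_nat_eq_top)
      then show ?thesis by (rule order_trans[OF top_greatest])
    qed
  qed
  also have "\<dots> = (SUP k. \<integral>\<^sup>+x. ennreal (t k x powr q) \<partial>lborel)"
    using q t0 t_mono by (intro nn_integral_monotone_convergence_SUP)
      (auto simp: incseq_def le_fun_def intro!: ennreal_leI powr_mono2)
  also have "\<dots> \<le> ennreal (K powr q)" by (intro SUP_least bound)
  finally show ?thesis .
qed

text \<open>For finite \<open>p\<close> the Jacobian, which is at least \<open>1\<close>, is
  discarded. The case \<open>c = 1\<close> gives translations, \<open>c = 2\<close> the map from
  \<open>x\<close> to \<open>2 *\<^sub>R x - y\<close>.\<close>

lemma Lp_norm_dilation_le:
  fixes f :: "'a::euclidean_space \<Rightarrow> ennreal"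
  assumes "0 < p" and [measurable]: "f \<in> borel_measurable borel" and c: "1 \<le> \<bar>c\<bar>"
  shows "Lp_norm p lborel (\<lambda>x. f (t + c *\<^sub>R x)) \<le> Lp_norm p lborel f"
  using assms(1)
proof (cases p rule: exponent_cases)
  case infinity
  have "AE x in lborel. f (t + c *\<^sub>R x) \<le> esssup lborel f"
    by (rule AE_lborel_affine[OF esssup_AE]) (use c in auto)
  then show ?thesis using infinity by (simp add: esssup_I)
next
  case (real r)
  have "(\<integral>\<^sup>+x. ennpowr (f (t + c *\<^sub>R x)) r \<partial>lborel) = 1 * (\<integral>\<^sup>+x. ennpowr (f (t + c *\<^sub>R x)) r \<partial>lborel)"
    by simp
  also have "\<dots> \<le> ennreal (\<bar>c\<bar> ^ DIM('a)) * (\<integral>\<^sup>+x. ennpowr (f (t + c *\<^sub>R x)) r \<partial>lborel)"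
    using c by (intro mult_right_mono) auto
  also have "\<dots> = (\<integral>\<^sup>+x. ennpowr (f x) r \<partial>lborel)"
    by (rule nn_integral_lborel_affine[symmetric]) (use c in auto)
  finally show ?thesis using real by (simp add: Lp_norm_real ennpowr_mono)
qed

text \<open>The integral of a nonnegative function always has a value, so the estimates are free of
  integrability conditions. At \<open>t = 0\<close> the kernel is \<open>0\<close>, because
  \<open>0 powr - l = 0\<close>; this agrees with the division by zero in
  \<open>L_integrand\<close>.\<close>

definition nn_L_op :: "real \<Rightarrow> ('a \<times> 'a \<Rightarrow> ennreal) \<Rightarrow> 'a::euclidean_space \<Rightarrow> ennreal" where
  "nn_L_op l F x = (\<integral>\<^sup>+t. F (x - t, x + t) * ennreal (norm t powr - l) \<partial>lborel)"

lemma borel_measurable_nn_L_op [measurable]: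
  assumes [measurable]: "F \<in> borel_measurable borel"
  shows "nn_L_op l F \<in> borel_measurable borel"
  unfolding nn_L_op_def by measurable

text \<open>In this form the second argument of \<open>F\<close> does not involve \<open>x\<close>;
  after exchanging integrals, only the first argument moves for fixed \<open>y\<close>, as the
  innermost norm demands.\<close>

lemma nn_L_op_eq:
  assumes [measurable]: "F \<in> borel_measurable borel"
  shows "nn_L_op l F x = (\<integral>\<^sup>+y. F (2 *\<^sub>R x - y, y) * ennreal (norm (y - x) powr - l) \<partial>lborel)"
proof -
  have "x - (y - x) = 2 *\<^sub>R x - y" for y by (simp add: scaleR_2)
  note eq = this
  show ?thesis unfolding nn_L_op_def
    by (subst nn_integral_lborel_affine[where c=1 and t="-x"]) (simp_all add: eq)
qed

text \<open>Duality, Tonelli, Hoelder's inequality in \<open>x\<close> for fixed \<open>y\<close>,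
  and the potential estimate in \<open>y\<close>. The conclusion entails that
  \<open>nn_L_op l F\<close> is finite almost everywhere, from which integrability of the complex
  integrand is drawn later.\<close>

lemma nn_L_op_bound:
  fixes p1 :: ennreal and p2 q l :: real
  assumes p1: "1 < p1" and p2: "1 < p2" and pq: "p2 < q" and qp: "enn2real (1 / p1) * q < 1"
    and l: "0 < l" "l < real DIM('a::euclidean_space)"
    and sum: "enn2real (1 / p1) + 1 / p2 = 1 / q + (real DIM('a) - l) / real DIM('a)"
  shows "\<exists>C>0. \<forall>(F :: 'a \<times> 'a \<Rightarrow> ennreal) m. F \<in> borel_measurable borel \<longrightarrow> 0 < m \<longrightarrow>
     Lp_norm (ennreal p2) lborel (\<lambda>y. Lp_norm p1 lborel (\<lambda>u. F (u, y))) \<le> ennreal m \<longrightarrow>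
     (\<integral>\<^sup>+x. ennpowr (nn_L_op l F x) q \<partial>lborel) \<le> ennreal ((C * m) powr q)"
proof -
  define a1 where "a1 = enn2real (1 / p1)"
  define s where "s = 1 / (1 - a1)"
  have p10: "0 < p1" using p1 by (meson less_trans zero_less_one)
  have q: "1 < q" using p2 pq by simp
  have "a1 < 1"
  proof -
    have "a1 * q < 1 * q" using qp q unfolding a1_def by linarith
    then show ?thesis using q by simp
  qed
  then have s: "a1 + 1 / s = 1" "0 < s" by (auto simp: s_def)
  have a10: "0 \<le> a1" by (simp add: a1_def)
  obtain C where C: "0 < C" "\<forall>(G :: 'a \<Rightarrow> real) \<phi> m b. G \<in> borel_measurable borel \<longrightarrow> \<phi> \<in> borel_measurable borel \<longrightarrow>
     (\<forall>x. 0 \<le> G x) \<longrightarrow> (\<forall>x. 0 \<le> \<phi> x) \<longrightarrow> 0 < m \<longrightarrow> 0 < b \<longrightarrow>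
     (\<integral>\<^sup>+x. ennreal (G x powr p2) \<partial>lborel) \<le> ennreal (m powr p2) \<longrightarrow>
     (\<integral>\<^sup>+x. ennreal (\<phi> x powr (q / (q - 1))) \<partial>lborel) \<le> ennreal (b powr (q / (q - 1))) \<longrightarrow>
     (\<integral>\<^sup>+y. ennreal (G y) * ennpowr (\<integral>\<^sup>+v. ennreal ((norm (y - v) powr - l * \<phi> v) powr s) \<partial>lborel) (1 / s) \<partial>lborel)
       \<le> ennreal (C * m * b)"
    using Holder_Riesz_potential[OF a10 p2 pq _ l] qp sum unfolding a1_def[symmetric] s_def
    by (elim meta_impE exE conjE) (simp_all add: that)
  show ?thesis
  proof (intro exI[of _ C] conjI allI impI C(1))
    fix F :: "'a \<times> 'a \<Rightarrow> ennreal" and m :: real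
    assume F[measurable]: "F \<in> borel_measurable borel" and m: "0 < m"
      and norm: "Lp_norm (ennreal p2) lborel (\<lambda>y. Lp_norm p1 lborel (\<lambda>u. F (u, y))) \<le> ennreal m"
    have F'[measurable]: "F \<in> borel_measurable (lborel \<Otimes>\<^sub>M lborel)"
      by (simp add: lborel_prod)
    define G where "G y = Lp_norm p1 lborel (\<lambda>u. F (u, y))" for y
    have [measurable]: "G \<in> borel_measurable borel"
      using measurable_Lp_norm_Pair[OF sigma_finite_lborel p10 F'] by (simp add: G_def[abs_def])
    have G: "(\<integral>\<^sup>+y. ennpowr (G y) p2 \<partial>lborel) \<le> ennreal (m powr p2)"
    proof -
      have "ennpowr (ennpowr (\<integral>\<^sup>+y. ennpowr (G y) p2 \<partial>lborel) (1 / p2)) p2 \<le> ennpowr (ennreal m) p2"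
        using norm p2 by (intro ennpowr_mono) (auto simp: Lp_norm_real G_def)
      then show ?thesis using p2 m by simp
    qed
    \<comment> \<open>The inner norm may be infinite on a null set, whereas the potential estimate
      speaks of real functions.\<close>
    define g where "g y = enn2real (G y)" for y
    have [measurable]: "g \<in> borel_measurable borel" unfolding g_def by measurable
    have "AE y in lborel. ennpowr (G y) p2 \<noteq> \<infinity>"
      by (rule nn_integral_PInf_AE) (use G in \<open>auto simp: top_unique\<close>)
    then have Gg: "AE y in lborel. G y = ennreal (g y)"
      by eventually_elim (auto simp: g_def less_top)
    have g: "(\<integral>\<^sup>+y. ennreal (g y powr p2) \<partial>lborel) \<le> ennreal (m powr p2)"
    proof -
      have "(\<integral>\<^sup>+y. ennreal (g y powr p2) \<partial>lborel) = (\<integral>\<^sup>+y. ennpowr (G y) p2 \<partial>lborel)"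
      proof (rule nn_integral_cong_AE)
        show "AE y in lborel. ennreal (g y powr p2) = ennpowr (G y) p2"
          using Gg by eventually_elim (metis ennpowr_ennreal enn2real_nonneg g_def)
      qed
      then show ?thesis using G by simp
    qed
    show "(\<integral>\<^sup>+x. ennpowr (nn_L_op l F x) q \<partial>lborel) \<le> ennreal ((C * m) powr q)"
    proof (rule nn_integral_ennpowr_le_of_duality[OF _ q])
      fix \<phi> :: "'a \<Rightarrow> real" and b :: real
      assume [measurable]: "\<phi> \<in> borel_measurable borel" and \<phi>0: "\<forall>x. 0 \<le> \<phi> x" and b: "0 < b"
        and \<phi>: "(\<integral>\<^sup>+x. ennreal (\<phi> x powr (q / (q - 1))) \<partial>lborel) \<le> ennreal (b powr (q / (q - 1)))"
      define k where "k y x = ennreal (norm (y - x) powr - l * \<phi> x)" for x y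
      have "(\<integral>\<^sup>+x. nn_L_op l F x * ennreal (\<phi> x) \<partial>lborel)
         = (\<integral>\<^sup>+x. \<integral>\<^sup>+y. F (2 *\<^sub>R x - y, y) * k y x \<partial>lborel \<partial>lborel)"
        unfolding nn_L_op_eq[OF F] k_def using \<phi>0
        by (simp add: nn_integral_multc[symmetric] ennreal_mult mult.assoc)
      also have "\<dots> = (\<integral>\<^sup>+y. \<integral>\<^sup>+x. F (2 *\<^sub>R x - y, y) * k y x \<partial>lborel \<partial>lborel)"
        unfolding k_def by (rule lborel_pair.Fubini') simp
      also have "\<dots> \<le> (\<integral>\<^sup>+y. G y * ennpowr (\<integral>\<^sup>+x. ennpowr (k y x) s \<partial>lborel) (1 / s) \<partial>lborel)"
      proof (rule nn_integral_mono)
        fix y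
        have "(\<integral>\<^sup>+x. F (2 *\<^sub>R x - y, y) * k y x \<partial>lborel)
          \<le> Lp_norm p1 lborel (\<lambda>x. F (2 *\<^sub>R x - y, y)) * ennpowr (\<integral>\<^sup>+x. ennpowr (k y x) s \<partial>lborel) (1 / s)"
          by (rule Holder_Lp_norm[OF _ _ p1]) (use s in \<open>auto simp: k_def a1_def\<close>)
        \<comment> \<open>The map from \<open>x\<close> to \<open>2 *\<^sub>R x - y\<close> expands,
          so composing with it does not increase the norm.\<close>
        also have "Lp_norm p1 lborel (\<lambda>x. F (2 *\<^sub>R x - y, y)) \<le> G y"
          using Lp_norm_dilation_le[OF p10, of "\<lambda>u. F (u, y)" 2 "- y"] by (simp add: G_def)
        finally show "(\<integral>\<^sup>+x. F (2 *\<^sub>R x - y, y) * k y x \<partial>lborel)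
          \<le> G y * ennpowr (\<integral>\<^sup>+x. ennpowr (k y x) s \<partial>lborel) (1 / s)"
          by (simp add: mult_right_mono)
      qed
      also have "\<dots> = (\<integral>\<^sup>+y. ennreal (g y) * ennpowr (\<integral>\<^sup>+v. ennreal ((norm (y - v) powr - l * \<phi> v) powr s) \<partial>lborel) (1 / s) \<partial>lborel)"
        using Gg \<phi>0 by (intro nn_integral_cong_AE) (auto elim!: eventually_mono simp: k_def)
      also have "\<dots> \<le> ennreal (C * m * b)"
        by (rule C(2)[rule_format]) (use g \<phi> \<phi>0 m b in \<open>auto simp: g_def\<close>)
      finally show "(\<integral>\<^sup>+x. nn_L_op l F x * ennreal (\<phi> x) \<partial>lborel) \<le> ennreal (C * m * b)" .
    qed (use C m in auto)
  qed
qed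

section \<open>Sufficiency\<close>

lemma inverse_exponent_eq:
  assumes "0 < p"
  shows "1 / p = ennreal (enn2real (1 / p))"
  using assms
proof (cases p rule: exponent_cases)
  case (real r)
  then show ?thesis by (metis divide_ennreal ennreal_1 zero_le_one)
qed auto

text \<open>Conditions on exponents become real inequalities between reciprocals, among which
  infinity is the ordinary value \<open>0\<close>.\<close>

lemma exponent_less_iff:
  assumes "0 < p" "0 < q"
  shows "p < q \<longleftrightarrow> enn2real (1 / q) < enn2real (1 / p)"
  using assms(1)
proof (cases p rule: exponent_cases)
  case infinity
  then show ?thesis using enn2real_nonneg[of "1 / q"] by (simp add: not_less)
next
  case p: (real r)
  show ?thesis using assms(2)
  proof (cases q rule: exponent_cases)
    case infinity
    then show ?thesis using p by simp
  next
    case (real t)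
    then show ?thesis
      using p(1) unfolding p(3) real(3) unfolding p(2) real(2)
      by (auto simp: ennreal_less_iff field_simps)
  qed
qed

section \<open>Null sets and Borel representatives\<close>

lemma AE_lborel_Pair_swap:
  fixes N :: "('a::euclidean_space \<times> 'a) set"
  assumes "N \<in> null_sets lborel"
  shows "AE y in lborel. AE x in lborel. (x, y) \<notin> N"
proof -
  have N: "N \<in> null_sets (lborel \<Otimes>\<^sub>M lborel)" using assms by (simp add: lborel_prod)
  then have [measurable]: "N \<in> sets (lborel \<Otimes>\<^sub>M lborel)" by auto
  have "AE x in lborel. AE y in lborel. (x, y) \<notin> N"
    by (rule lborel_pair.AE_pair[of "\<lambda>z. z \<notin> N"]) (rule AE_not_in[OF N])
  moreover have "(AE x in lborel. AE y in lborel. (x, y) \<notin> N) \<longleftrightarrow> (AE y in lborel. AE x in lborel. (x, y) \<notin> N)"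
    by (rule lborel_pair.AE_commute) measurable
  ultimately show ?thesis by simp
qed

text \<open>It ensures that changing \<open>f\<close> on a null set affects its integrals along the
  sections at almost no \<open>x\<close>. The linear map is split into two affine maps of a single
  variable, with an exchange of quantifiers in between.\<close>

lemma AE_lborel_L_op_section:
  fixes N :: "('a::euclidean_space \<times> 'a) set"
  assumes "N \<in> null_sets lborel"
  shows "AE x in lborel. AE t in lborel. (x - t, x + t) \<notin> N"
proof -
  have [measurable]: "N \<in> sets (lborel \<Otimes>\<^sub>M lborel)"
    unfolding lborel_prod using assms by (rule null_setsD2)
  have "AE y in lborel. AE x in lborel. (2 *\<^sub>R x - y, y) \<notin> N"
    using AE_lborel_Pair_swap[OF assms]
  proof eventually_elim
    case (elim y)
    from AE_lborel_affine[OF this, of 2 "- y"] show ?case by simp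
  qed
  moreover have "(AE x in lborel. AE y in lborel. (2 *\<^sub>R x - y, y) \<notin> N)
      \<longleftrightarrow> (AE y in lborel. AE x in lborel. (2 *\<^sub>R x - y, y) \<notin> N)"
    by (rule lborel_pair.AE_commute) measurable
  ultimately have "AE x in lborel. AE y in lborel. (2 *\<^sub>R x - y, y) \<notin> N" by simp
  then show ?thesis
  proof eventually_elim
    case (elim x)
    have eq: "2 *\<^sub>R x - (x + t) = x - t" for t by (simp add: scaleR_2)
    from AE_lborel_affine[OF elim, of 1 x] show ?case by (simp add: eq)
  qed
qed

text \<open>Tonelli arguments require measurability for the product sigma-algebra, which a Lebesgue
  measurable function on the product space need not have.\<close>

lemma lebesgue_measurable_complex_Borel_version:
  fixes f :: "'a::euclidean_space \<Rightarrow> complex"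
  assumes [measurable]: "f \<in> borel_measurable lebesgue"
  obtains g N where "g \<in> borel_measurable borel" "N \<in> null_sets lborel" "\<And>z. z \<notin> N \<Longrightarrow> f z = g z"
proof -
  have "(\<lambda>z. Re (f z)) \<in> borel_measurable lebesgue" "(\<lambda>z. Im (f z)) \<in> borel_measurable lebesgue"
    by measurable
  then obtain r i where ri[measurable]: "r \<in> borel_measurable borel" "i \<in> borel_measurable borel"
    and AE: "AE z in lborel. Re (f z) = r z" "AE z in lborel. Im (f z) = i z"
    using completion_ex_borel_measurable_real[of "\<lambda>z. Re (f z)" lborel]
      completion_ex_borel_measurable_real[of "\<lambda>z. Im (f z)" lborel] by auto
  define g where "g z = complex_of_real (r z) + \<i> * complex_of_real (i z)" for z
  have "g \<in> borel_measurable borel" unfolding g_def by measurable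
  moreover have "AE z in lborel. f z = g z"
    using AE by eventually_elim (simp add: g_def complex_eq_iff)
  then obtain N where "N \<in> null_sets lborel" "{z. f z \<noteq> g z} \<subseteq> N"
    by (auto simp: eventually_ae_filter)
  ultimately show ?thesis using that by blast
qed

lemma mixed_norm_eq_lborel:
  fixes g :: "(real^'n) \<times> (real^'n) \<Rightarrow> complex"
  assumes p: "0 < p1" "0 < p2" and [measurable]: "g \<in> borel_measurable borel"
  shows "mixed_norm p1 p2 g = Lp_norm p2 lborel (\<lambda>y. Lp_norm p1 lborel (\<lambda>u. ennreal (cmod (g (u, y)))))"
proof -
  have "(\<lambda>z. ennreal (cmod (g z))) \<in> borel_measurable (lborel \<Otimes>\<^sub>M lborel)"
    by (simp add: lborel_prod)
  from measurable_Lp_norm_Pair[OF sigma_finite_lborel p(1) this]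
  have [measurable]: "(\<lambda>y. Lp_norm p1 lborel (\<lambda>u. ennreal (cmod (g (u, y))))) \<in> borel_measurable borel"
    by simp
  have "Lp_norm p1 lebesgue (\<lambda>u. ennreal (cmod (g (u, y)))) = Lp_norm p1 lborel (\<lambda>u. ennreal (cmod (g (u, y))))" for y
    by (rule Lp_norm_completion[OF p(1)]) simp
  then show ?thesis unfolding mixed_norm_def
    using Lp_norm_completion[OF p(2), of "\<lambda>y. Lp_norm p1 lborel (\<lambda>u. ennreal (cmod (g (u, y))))" lborel] by simp
qed

text \<open>For almost every \<open>y\<close> the two sections agree almost everywhere. Monotonicity
  of the norm asks for measurability of the smaller side, which is the Borel one.\<close>

lemma mixed_norm_Borel_version_le:
  fixes f g :: "(real^'n) \<times> (real^'n) \<Rightarrow> complex"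
  assumes p: "0 < p1" "0 < p2" and [measurable]: "g \<in> borel_measurable borel"
    and N: "N \<in> null_sets lborel" and fg: "\<And>z. z \<notin> N \<Longrightarrow> f z = g z"
  shows "Lp_norm p2 lborel (\<lambda>y. Lp_norm p1 lborel (\<lambda>u. ennreal (cmod (g (u, y))))) \<le> mixed_norm p1 p2 f"
proof -
  have "(\<lambda>z. ennreal (cmod (g z))) \<in> borel_measurable (lborel \<Otimes>\<^sub>M lborel)"
    by (simp add: lborel_prod)
  from measurable_Lp_norm_Pair[OF sigma_finite_lborel p(1) this]
  have G[measurable]: "(\<lambda>y. Lp_norm p1 lborel (\<lambda>u. ennreal (cmod (g (u, y))))) \<in> borel_measurable borel"
    by simp
  have "AE y in lborel. Lp_norm p1 lborel (\<lambda>u. ennreal (cmod (g (u, y)))) \<le> Lp_norm p1 lebesgue (\<lambda>u. ennreal (cmod (f (u, y))))"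
    using AE_lborel_Pair_swap[OF N]
  proof eventually_elim
    case (elim y)
    have "Lp_norm p1 lborel (\<lambda>u. ennreal (cmod (g (u, y)))) = Lp_norm p1 lebesgue (\<lambda>u. ennreal (cmod (g (u, y))))"
      by (rule Lp_norm_completion[OF p(1), symmetric]) simp
    also have "\<dots> \<le> Lp_norm p1 lebesgue (\<lambda>u. ennreal (cmod (f (u, y))))"
    proof (rule Lp_norm_mono_AE[OF p(1)])
      have "AE u in lebesgue. (u, y) \<notin> N" using elim by (rule AE_completion)
      then show "AE u in lebesgue. ennreal (cmod (g (u, y))) \<le> ennreal (cmod (f (u, y)))"
        by eventually_elim (simp add: fg)
    qed (auto intro!: measurable_completion)
    finally show ?case .
  qed
  then have *: "AE y in lebesgue. Lp_norm p1 lborel (\<lambda>u. ennreal (cmod (g (u, y)))) \<le> Lp_norm p1 lebesgue (\<lambda>u. ennreal (cmod (f (u, y))))"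
    by (rule AE_completion)
  have "Lp_norm p2 lborel (\<lambda>y. Lp_norm p1 lborel (\<lambda>u. ennreal (cmod (g (u, y)))))
    = Lp_norm p2 lebesgue (\<lambda>y. Lp_norm p1 lborel (\<lambda>u. ennreal (cmod (g (u, y)))))"
    by (rule Lp_norm_completion[OF p(2), symmetric]) (use G in simp)
  also have "\<dots> \<le> mixed_norm p1 p2 f" unfolding mixed_norm_def
    by (rule Lp_norm_mono_AE[OF p(2) _ *]) (use G in \<open>auto intro!: measurable_completion\<close>)
  finally show ?thesis .
qed

section \<open>Passage from the positive operator to the complex one\<close>

lemma L_integrand_measurable [measurable]:
  assumes [measurable]: "g \<in> borel_measurable borel"
  shows "L_integrand l g x \<in> borel_measurable borel"
  unfolding L_integrand_def by measurable

lemma nn_integral_cmod_L_integrand: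
  "(\<integral>\<^sup>+t. ennreal (cmod (L_integrand l g x t)) \<partial>lborel) = nn_L_op l (\<lambda>z. ennreal (cmod (g z))) x"
  unfolding nn_L_op_def L_integrand_def norm_divide norm_of_real
  by (simp add: ennreal_mult[symmetric] powr_minus divide_inverse)

text \<open>With \<open>g\<close> a Borel representative of \<open>f\<close>, the positive operator
  applied to the modulus of \<open>g\<close> dominates the modulus of \<open>L_op l f\<close>, and
  wherever it is finite the integrand is integrable.\<close>

lemma L_op_bound_of_nn_L_op_bound:
  fixes f :: "(real^'n) \<times> (real^'n) \<Rightarrow> complex" and p1 p2 :: ennreal and q l C :: real
  assumes p: "0 < p1" "0 < p2" and q: "0 < q" and C: "0 < C"
    and bound: "\<And>(F :: (real^'n) \<times> (real^'n) \<Rightarrow> ennreal) m. F \<in> borel_measurable borel \<Longrightarrow> 0 < m \<Longrightarrow>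
     Lp_norm p2 lborel (\<lambda>y. Lp_norm p1 lborel (\<lambda>u. F (u, y))) \<le> ennreal m \<Longrightarrow>
     (\<integral>\<^sup>+x. ennpowr (nn_L_op l F x) q \<partial>lborel) \<le> ennreal ((C * m) powr q)"
    and f: "f \<in> mixed_Lp p1 p2"
  shows "AE x in lebesgue. integrable lebesgue (L_integrand l f x)"
    and "Lp_norm (ennreal q) lebesgue (\<lambda>x. ennreal (cmod (L_op l f x))) \<le> ennreal C * mixed_norm p1 p2 f"
proof -
  have fm: "f \<in> borel_measurable lebesgue" and fin: "mixed_norm p1 p2 f < \<infinity>"
    using f by (auto simp: mixed_Lp_def)
  obtain g N where g[measurable]: "g \<in> borel_measurable borel" and N: "N \<in> null_sets lborel"
    and fg: "\<And>z. z \<notin> N \<Longrightarrow> f z = g z"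
    using lebesgue_measurable_complex_Borel_version[OF fm] by metis
  define F where "F z = ennreal (cmod (g z))" for z
  have [measurable]: "F \<in> borel_measurable borel" unfolding F_def by measurable
  obtain M where M: "0 \<le> M" "mixed_norm p1 p2 f = ennreal M" using fin by (cases "mixed_norm p1 p2 f") auto
  \<comment> \<open>The assumed bound takes a positive \<open>m\<close>, while the norm
    \<open>M\<close> may be \<open>0\<close>. The estimate is therefore proved for all positive
    \<open>m \<ge> M\<close>, and \<open>m = M + e / C\<close> with arbitrary \<open>e\<close>
    recovers \<open>M\<close> in the end.\<close>
  have TF: "(\<integral>\<^sup>+x. ennpowr (nn_L_op l F x) q \<partial>lborel) \<le> ennreal ((C * m) powr q)" if "0 < m" "M \<le> m" for m
  proof (rule bound)
    have "Lp_norm p2 lborel (\<lambda>y. Lp_norm p1 lborel (\<lambda>u. F (u, y))) \<le> ennreal M"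
      unfolding F_def M(2)[symmetric] by (rule mixed_norm_Borel_version_le[OF p g N fg])
    also have "\<dots> \<le> ennreal m" using that by (intro ennreal_leI)
    finally show "Lp_norm p2 lborel (\<lambda>y. Lp_norm p1 lborel (\<lambda>u. F (u, y))) \<le> ennreal m" .
  qed (use that in auto)
  have "AE x in lborel. ennpowr (nn_L_op l F x) q \<noteq> \<infinity>"
    using TF[of "M + 1"] M(1) by (intro nn_integral_PInf_AE) (auto simp: top_unique)
  then have key: "AE x in lborel. integrable lebesgue (L_integrand l f x)
      \<and> ennreal (cmod (L_op l f x)) \<le> nn_L_op l F x"
    using AE_lborel_L_op_section[OF N]
  proof eventually_elim
    case (elim x)
    have int: "integrable lborel (L_integrand l g x)"
      using elim(1) by (intro integrableI_bounded)
        (auto simp: nn_integral_cmod_L_integrand F_def[abs_def] less_top)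
    then have int': "integrable lebesgue (L_integrand l g x)"
      by (intro integrable_completion[THEN iffD2]) auto
    have "AE t in lborel. L_integrand l g x t = L_integrand l f x t"
      using elim(2) by eventually_elim (simp add: L_integrand_def fg)
    then have ae: "AE t in lebesgue. L_integrand l g x t = L_integrand l f x t"
      by (rule AE_completion)
    have "L_integrand l f x \<in> borel_measurable lebesgue"
      by (rule borel_measurable_AE[OF _ ae]) (use int' in auto)
    then have int_f: "integrable lebesgue (L_integrand l f x)"
      using integrable_cong_AE[of "L_integrand l g x" lebesgue "L_integrand l f x"] int' ae by auto
    have "ennreal (cmod (L_op l f x)) \<le> (\<integral>\<^sup>+t. ennreal (cmod (L_integrand l f x t)) \<partial>lebesgue)"
      unfolding L_op_def by (rule integral_norm_bound_ennreal[OF int_f])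
    also have "\<dots> = (\<integral>\<^sup>+t. ennreal (cmod (L_integrand l g x t)) \<partial>lebesgue)"
      using ae by (intro nn_integral_cong_AE) (auto elim!: eventually_mono)
    also have "\<dots> = nn_L_op l F x"
      by (simp add: nn_integral_completion nn_integral_cmod_L_integrand F_def[abs_def])
    finally show ?case using int_f by simp
  qed
  then show "AE x in lebesgue. integrable lebesgue (L_integrand l f x)"
    by (intro AE_completion) (auto elim: eventually_mono)
  have norm_le: "Lp_norm (ennreal q) lebesgue (\<lambda>x. ennreal (cmod (L_op l f x))) \<le> ennreal (C * m)"
    if m: "0 < m" "M \<le> m" for m
  proof -
    have "(\<integral>\<^sup>+x. ennpowr (ennreal (cmod (L_op l f x))) q \<partial>lebesgue) \<le> (\<integral>\<^sup>+x. ennpowr (nn_L_op l F x) q \<partial>lborel)"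
      unfolding nn_integral_completion
    proof (rule nn_integral_mono_AE)
      show "AE x in lborel. ennpowr (ennreal (cmod (L_op l f x))) q \<le> ennpowr (nn_L_op l F x) q"
        using key by eventually_elim (intro ennpowr_mono; use q in simp)
    qed
    also note TF[OF m]
    finally have "ennpowr (\<integral>\<^sup>+x. ennpowr (ennreal (cmod (L_op l f x))) q \<partial>lebesgue) (1 / q) \<le> ennpowr (ennreal ((C * m) powr q)) (1 / q)"
      using q by (intro ennpowr_mono) auto
    then show ?thesis using q C m by (simp add: Lp_norm_real powr_powr)
  qed
  show "Lp_norm (ennreal q) lebesgue (\<lambda>x. ennreal (cmod (L_op l f x))) \<le> ennreal C * mixed_norm p1 p2 f"
  proof (rule ennreal_le_epsilon)
    fix e :: real assume "0 < e"
    then have "Lp_norm (ennreal q) lebesgue (\<lambda>x. ennreal (cmod (L_op l f x))) \<le> ennreal (C * (M + e / C))"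
      using C M(1) by (intro norm_le) (auto intro!: add_nonneg_pos)
    also have "\<dots> = ennreal C * mixed_norm p1 p2 f + ennreal e"
      using C M \<open>0 < e\<close> by (simp add: ennreal_mult[symmetric] ennreal_plus[symmetric] distrib_left del: ennreal_plus)
    finally show "Lp_norm (ennreal q) lebesgue (\<lambda>x. ennreal (cmod (L_op l f x))) \<le> ennreal C * mixed_norm p1 p2 f + ennreal e" .
  qed
qed

lemma exponent_relation_real:
  assumes "0 < p1" "0 < p2" "0 < q" "0 \<le> \<alpha>" and eq: "1 / p1 + 1 / p2 = 1 / q + ennreal \<alpha>"
  shows "enn2real (1 / p1) + enn2real (1 / p2) = enn2real (1 / q) + \<alpha>"
proof -
  have "ennreal (enn2real (1 / p1)) + ennreal (enn2real (1 / p2)) = ennreal (enn2real (1 / q)) + ennreal \<alpha>"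
    using eq assms by (simp only: inverse_exponent_eq[symmetric])
  then have "ennreal (enn2real (1 / p1) + enn2real (1 / p2)) = ennreal (enn2real (1 / q) + \<alpha>)"
    using assms by simp
  then show ?thesis using assms by (subst (asm) ennreal_inj) auto
qed

lemma L_op_bounded:
  fixes p1 p2 q :: ennreal and l :: real
  assumes p2: "1 < p2" and pq: "p2 < q" and qp: "q < p1"
    and l: "0 < l" "l < real CARD('n::finite)"
    and sum: "1 / p1 + 1 / p2 = 1 / q + ennreal ((real CARD('n) - l) / real CARD('n))"
  shows "\<exists>C::real. \<forall>f \<in> (mixed_Lp p1 p2 :: ((real^'n) \<times> (real^'n) \<Rightarrow> complex) set).
            (AE x in lebesgue. integrable lebesgue (L_integrand l f x)) \<and>
            Lp_norm q lebesgue (\<lambda>x. ennreal (cmod (L_op l f x))) \<le> ennreal C * mixed_norm p1 p2 f"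
proof -
  have pos: "0 < p2" "0 < q" "0 < p1"
    using p2 pq qp by (meson less_trans zero_less_one)+
  \<comment> \<open>\<open>p2\<close> and \<open>q\<close> are finite because each lies strictly
    below another exponent.\<close>
  obtain r2 where r2: "0 < r2" "p2 = ennreal r2" "enn2real (1 / p2) = 1 / r2"
    using pos(1) by (cases p2 rule: exponent_cases) (use pq in auto)
  obtain rq where rq: "0 < rq" "q = ennreal rq" "enn2real (1 / q) = 1 / rq"
    using pos(2) by (cases q rule: exponent_cases) (use qp in auto)
  have "1 < r2" using p2 r2 by (metis ennreal_1 ennreal_less_iff zero_le_one)
  moreover have "r2 < rq" using pq r2 rq by (simp add: ennreal_less_iff)
  moreover have "enn2real (1 / p1) * rq < 1"
    using qp rq(1) unfolding exponent_less_iff[OF pos(2,3)] rq(3) by (simp add: field_simps)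
  moreover have "1 < p1" using p2 pq qp by order
  moreover have "enn2real (1 / p1) + 1 / r2 = 1 / rq + (real CARD('n) - l) / real CARD('n)"
    using exponent_relation_real[OF pos(3,1,2) _ sum] l r2 rq by simp
  ultimately obtain C where C: "0 < C" "\<forall>(F :: (real^'n) \<times> (real^'n) \<Rightarrow> ennreal) m. F \<in> borel_measurable borel \<longrightarrow> 0 < m \<longrightarrow>
     Lp_norm (ennreal r2) lborel (\<lambda>y. Lp_norm p1 lborel (\<lambda>u. F (u, y))) \<le> ennreal m \<longrightarrow>
     (\<integral>\<^sup>+x. ennpowr (nn_L_op l F x) rq \<partial>lborel) \<le> ennreal ((C * m) powr rq)"
    using nn_L_op_bound[of p1 r2 rq l, where 'a="real^'n"] l by auto
  show ?thesis
    unfolding rq(2)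
    by (intro exI[of _ C] ballI conjI L_op_bound_of_nn_L_op_bound[OF pos(3,1) rq(1) C(1)])
       (use C(2) r2 in auto)
qed

section \<open>Necessity\<close>

text \<open>The common end of the counterexamples: a positive power of every \<open>k\<close> would
  be bounded.\<close>

lemma powr_unbounded:
  fixes d C :: real
  assumes "0 < d" and bound: "\<And>k::nat. 1 \<le> k \<Longrightarrow> real k powr d \<le> C"
  shows False
proof -
  have "1 \<le> C" using bound[of 1] by simp
  obtain k :: nat where k: "(C + 1) powr (1 / d) \<le> real k" using real_arch_simple by blast
  have "0 < (C + 1) powr (1 / d)" using \<open>1 \<le> C\<close> by simp
  then have "1 \<le> k" using k by (cases k) auto
  have "((C + 1) powr (1 / d)) powr d \<le> real k powr d"
    using k assms(1) by (intro powr_mono2) auto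
  then have "C + 1 \<le> real k powr d" using assms(1) \<open>1 \<le> C\<close> by (simp add: powr_powr)
  then show False using bound[OF \<open>1 \<le> k\<close>] by simp
qed

text \<open>Truncations of the homogeneous function that is critical for the exponent \<open>n / \<beta>\<close>.\<close>

definition annulus_powr :: "real \<Rightarrow> nat \<Rightarrow> 'a::euclidean_space \<Rightarrow> real" where
  "annulus_powr \<beta> k z = norm z powr - \<beta> * indicator {z. (1/2) ^ k \<le> norm z \<and> norm z < 1} z"

lemma annulus_powr_nonneg [simp]: "0 \<le> annulus_powr \<beta> k z"
  by (simp add: annulus_powr_def)

lemma annulus_powr_measurable [measurable]: "annulus_powr \<beta> k \<in> borel_measurable borel"
  unfolding annulus_powr_def by measurable

text \<open>Finiteness for a fixed \<open>k\<close> suffices where the contradiction comes from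
  dilation instead of from many shells.\<close>

lemma annulus_powr_Lp_norm_finite:
  assumes "0 < p"
  obtains H where "0 \<le> H" "Lp_norm p lborel (\<lambda>z::'a::euclidean_space. ennreal (annulus_powr \<beta> k z)) \<le> ennreal H"
proof -
  \<comment> \<open>The maximum covers both signs of \<open>\<beta>\<close>: the power is largest at
    the inner radius for nonnegative \<open>\<beta>\<close>, and below \<open>1\<close>
    otherwise.\<close>
  define B where "B = max (((1/2) ^ k) powr - \<beta>) 1"
  have B: "norm z powr - \<beta> \<le> B" if "(1/2) ^ k \<le> norm z" "norm z < 1" for z :: 'a
  proof (cases "0 \<le> \<beta>")
    case True
    have "norm z powr - \<beta> \<le> ((1/2) ^ k) powr - \<beta>" using True that by (intro powr_mono2') auto
    then show ?thesis by (simp add: B_def)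
  next
    case False
    have "norm z powr - \<beta> \<le> 1 powr - \<beta>" using False that by (intro powr_mono2) auto
    then show ?thesis by (simp add: B_def)
  qed
  have "Lp_norm p lborel (\<lambda>z::'a. ennreal (annulus_powr \<beta> k z)) \<le> Lp_norm p lborel (\<lambda>z::'a. ennreal B * indicator (ball 0 1) z)"
    using B by (intro Lp_norm_mono assms)
      (auto simp: annulus_powr_def indicator_def intro!: ennreal_leI)
  also have "\<dots> = ennreal B * ennreal (unit_ball_vol (real DIM('a)) powr enn2real (1 / p))"
    by (rule Lp_norm_cindicator[OF assms]) (auto simp: emeasure_ball)
  also have "\<dots> = ennreal (B * unit_ball_vol (real DIM('a)) powr enn2real (1 / p))"
    by (simp add: ennreal_mult B_def)
  finally show ?thesis
    by (rule that[rotated]) (auto simp: B_def intro!: mult_nonneg_nonneg)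
qed

text \<open>For real \<open>p\<close> the power of order \<open>p\<close> of the function is
  \<open>norm z powr - n\<close> on the annulus, \<open>n\<close> being the dimension. For infinite
  \<open>p\<close> the function is an indicator and the bound is \<open>1\<close>.\<close>

lemma annulus_powr_Lp_norm_critical:
  assumes c: "0 < c" "\<And>k. (\<integral>\<^sup>+x. ennreal (norm (x::'a::euclidean_space) powr - real DIM('a))
            * indicator {x. (1/2) ^ k \<le> norm x \<and> norm x < 1} x \<partial>lborel) = ennreal (c * real k)"
    and p: "0 < p" and k: "1 \<le> k"
  shows "Lp_norm p lborel (\<lambda>z::'a. ennreal (annulus_powr (real DIM('a) * enn2real (1 / p)) k z))
    \<le> ennreal ((c * real k) powr enn2real (1 / p))"
  using p
proof (cases p rule: exponent_cases)
  case infinity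
  then have "Lp_norm p lborel (\<lambda>z::'a. ennreal (annulus_powr (real DIM('a) * enn2real (1 / p)) k z)) \<le> 1"
    by (auto simp: annulus_powr_def indicator_def intro!: esssup_I)
  then show ?thesis using infinity c k by simp
next
  case (real r)
  have "(\<integral>\<^sup>+z. ennreal (annulus_powr (real DIM('a) * (1 / r)) k (z::'a) powr r) \<partial>lborel) = ennreal (c * real k)"
    unfolding c(2)[symmetric] using real(1)
    by (intro nn_integral_cong) (auto simp: annulus_powr_def indicator_def powr_powr)
  then show ?thesis using real c(1) unfolding real(3) by (simp add: Lp_norm_real)
qed

text \<open>The pairing with the kernel grows linearly in the number of shells, while the critical
  norm grows only like the power \<open>1 / p\<close>; the quotient is unbounded for
  \<open>p > 1\<close>.\<close>

lemma annulus_powr_pairing: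
  assumes "\<beta> + l = real DIM('a::euclidean_space)"
  shows "(\<integral>\<^sup>+z. ennreal (annulus_powr \<beta> k (z::'a) * norm z powr - l) \<partial>lborel)
    = (\<integral>\<^sup>+x. ennreal (norm (x::'a) powr - real DIM('a)) * indicator {x. (1/2) ^ k \<le> norm x \<and> norm x < 1} x \<partial>lborel)"
  unfolding assms[symmetric]
  by (intro nn_integral_cong) (auto simp: annulus_powr_def indicator_def powr_add[symmetric])

text \<open>The \<open>itself\<close> argument fixes the dimension, which the exponents and
  \<open>l\<close> do not determine. A negative \<open>C\<close> is allowed and acts as
  \<open>0\<close>.\<close>

definition L_op_inequality :: "ennreal \<Rightarrow> ennreal \<Rightarrow> ennreal \<Rightarrow> real \<Rightarrow> real \<Rightarrow> 'n::finite itself \<Rightarrow> bool" where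
  "L_op_inequality p1 p2 q l C (_ :: 'n itself) \<longleftrightarrow>
     (\<forall>f \<in> (mixed_Lp p1 p2 :: ((real^'n) \<times> (real^'n) \<Rightarrow> complex) set).
            (AE x in lebesgue. integrable lebesgue (L_integrand l f x)) \<and>
            Lp_norm q lebesgue (\<lambda>x. ennreal (cmod (L_op l f x))) \<le> ennreal C * mixed_norm p1 p2 f)"

text \<open>Reduces each counterexample to three estimates: \<open>G\<close> bounds the inner norms,
  \<open>M\<close> the outer norm, and \<open>g\<close> lies below the positive operator.\<close>

lemma L_op_inequality_nonneg:
  fixes F :: "(real^'n::finite) \<times> (real^'n) \<Rightarrow> real" and g G :: "real^'n \<Rightarrow> ennreal"
  assumes ineq: "L_op_inequality p1 p2 q l C TYPE('n)"
    and p: "0 < p1" "0 < p2" "0 < q"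
    and [measurable]: "F \<in> borel_measurable borel" and F0: "\<And>z. 0 \<le> F z"
    and inner: "\<And>y. Lp_norm p1 lborel (\<lambda>u. ennreal (F (u, y))) \<le> G y"
    and outer: "Lp_norm p2 lborel G \<le> ennreal M"
    and g[measurable]: "g \<in> borel_measurable borel"
    and g_le: "\<And>x. g x \<le> nn_L_op l (\<lambda>z. ennreal (F z)) x"
  shows "Lp_norm q lborel g \<le> ennreal C * ennreal M"
proof -
  define f where "f z = complex_of_real (F z)" for z
  have [measurable]: "f \<in> borel_measurable borel" unfolding f_def by measurable
  have cmod_f: "cmod (f z) = F z" for z using F0 by (simp add: f_def)
  have "(\<lambda>z. ennreal (F z)) \<in> borel_measurable (lborel \<Otimes>\<^sub>M lborel)"
    by (simp add: lborel_prod)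
  from measurable_Lp_norm_Pair[OF sigma_finite_lborel p(1) this]
  have "Lp_norm p2 lborel (\<lambda>y. Lp_norm p1 lborel (\<lambda>u. ennreal (F (u, y)))) \<le> Lp_norm p2 lborel G"
    by (intro Lp_norm_mono p inner)
  then have mixed: "mixed_norm p1 p2 f \<le> ennreal M"
    using outer by (simp add: mixed_norm_eq_lborel[OF p(1,2)] cmod_f)
  then have "f \<in> mixed_Lp p1 p2"
    by (auto simp: mixed_Lp_def intro!: measurable_completion le_less_trans[OF mixed])
  with ineq have ae: "AE x in lebesgue. integrable lebesgue (L_integrand l f x)"
    and le: "Lp_norm q lebesgue (\<lambda>x. ennreal (cmod (L_op l f x))) \<le> ennreal C * mixed_norm p1 p2 f"
    unfolding L_op_inequality_def by auto
  have "Lp_norm q lborel g = Lp_norm q lebesgue g"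
    by (rule Lp_norm_completion[OF p(3), symmetric]) simp
  also have "\<dots> \<le> Lp_norm q lebesgue (\<lambda>x. ennreal (cmod (L_op l f x)))"
  proof (rule Lp_norm_mono_AE[OF p(3)])
    show "g \<in> borel_measurable lebesgue" by (intro measurable_completion) simp
    show "AE x in lebesgue. g x \<le> ennreal (cmod (L_op l f x))"
      using ae
    proof eventually_elim
      case (elim x)
      define K where "K t = F (x - t, x + t) / norm t powr l" for t
      have K0: "0 \<le> K t" for t using F0 by (simp add: K_def)
      have LK: "L_integrand l f x = (\<lambda>t. complex_of_real (K t))"
        by (auto simp: L_integrand_def f_def K_def)
      \<comment> \<open>Integrability rules out the default value \<open>0\<close> of the Bochner
        integral, so both operators agree at \<open>x\<close> and the lower bound passes to
        \<open>L_op\<close>.\<close>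
      have int: "integrable lebesgue K"
        using integrable_Re[OF elim[unfolded LK]] by simp
      have "nn_L_op l (\<lambda>z. ennreal (F z)) x = (\<integral>\<^sup>+t. ennreal (K t) \<partial>lebesgue)"
        using F0 by (simp add: nn_L_op_def nn_integral_completion K_def ennreal_mult[symmetric] powr_minus divide_inverse)
      also have "\<dots> = ennreal (\<integral>t. K t \<partial>lebesgue)"
        using int K0 by (intro nn_integral_eq_integral) auto
      also have "(\<integral>t. K t \<partial>lebesgue) = cmod (L_op l f x)"
        unfolding L_op_def LK by (simp add: K0)
      finally show ?case using g_le[of x] by simp
    qed
  qed
  also note le
  also have "ennreal C * mixed_norm p1 p2 f \<le> ennreal C * ennreal M"
    by (intro mult_left_mono mixed) auto
  finally show ?thesis .
qed

text \<open>The test function depends on \<open>u - y\<close>, which equals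
  \<open>- 2 *\<^sub>R t\<close> in the integrand, and restricts \<open>y\<close> to a large ball.
  The operator is then constant on the ball of radius \<open>\<rho>\<close>, and the two sides grow
  with the volumes of balls to the powers \<open>1 / q\<close> and \<open>1 / p2\<close>.\<close>

lemma L_op_inequality_dilation_large:
  fixes l C :: real
  assumes ineq: "L_op_inequality p1 p2 q l C TYPE('n::finite)"
    and p: "0 < p1" "0 < p2" "0 < q"
  defines "n \<equiv> real CARD('n)"
  shows "\<exists>K\<ge>0. \<forall>(h :: real^'n \<Rightarrow> real) H J \<rho>. h \<in> borel_measurable borel \<longrightarrow> (\<forall>z. 0 \<le> h z) \<longrightarrow>
     (\<forall>z. 1 \<le> norm z \<longrightarrow> h z = 0) \<longrightarrow> 0 \<le> H \<longrightarrow> Lp_norm p1 lborel (\<lambda>z. ennreal (h z)) \<le> ennreal H \<longrightarrow>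
     0 \<le> J \<longrightarrow> ennreal J \<le> (\<integral>\<^sup>+z. ennreal (h z * norm z powr - l) \<partial>lborel) \<longrightarrow> 1 \<le> \<rho> \<longrightarrow>
     J * \<rho> powr (n * enn2real (1 / q)) \<le> K * H * \<rho> powr (n * enn2real (1 / p2))"
proof -
  define a b where "a = enn2real (1 / p2)" and "b = enn2real (1 / q)"
  define \<omega> where "\<omega> = unit_ball_vol n"
  have \<omega>: "0 < \<omega>" by (simp add: \<omega>_def n_def)
  \<comment> \<open>\<open>max 0 C\<close> is the real value of \<open>ennreal C\<close>; the rest
    collects the ball volumes and the factor from the substitution
    \<open>z = - 2 *\<^sub>R t\<close>.\<close>
  define K where "K = max 0 C * (\<omega> * 2 powr n) powr a / (2 powr (l - n) * \<omega> powr b)"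
  show ?thesis
    unfolding a_def[symmetric] b_def[symmetric]
  proof (intro exI[of _ K] conjI allI impI)
    show "0 \<le> K" by (simp add: K_def)
    fix h :: "real^'n \<Rightarrow> real" and H J \<rho> :: real
    assume [measurable]: "h \<in> borel_measurable borel" and h0: "\<forall>z. 0 \<le> h z"
      and supp: "\<forall>z. 1 \<le> norm z \<longrightarrow> h z = 0" and H0: "0 \<le> H"
      and H: "Lp_norm p1 lborel (\<lambda>z. ennreal (h z)) \<le> ennreal H"
      and J0: "0 \<le> J" and J: "ennreal J \<le> (\<integral>\<^sup>+z. ennreal (h z * norm z powr - l) \<partial>lborel)" and \<rho>: "1 \<le> \<rho>"
    define F where "F z = indicator (ball 0 (2 * \<rho>)) (snd z) * h (fst z - snd z)" for z
    define g where "g x = ennreal (2 powr (l - n) * J) * indicator (ball 0 \<rho>) x" for x :: "real^'n"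
    define G where "G y = ennreal H * indicator (ball 0 (2 * \<rho>)) y" for y :: "real^'n"
    have [measurable]: "ball (0::real^'n) r \<in> sets borel" for r by simp
    have F[measurable]: "F \<in> borel_measurable borel"
    proof -
      have "F = (\<lambda>(u, y). indicator (ball 0 (2 * \<rho>)) y * h (u - y))" by (auto simp: F_def)
      also have "\<dots> \<in> borel_measurable (borel \<Otimes>\<^sub>M borel)" by measurable
      finally show ?thesis by (simp add: borel_prod)
    qed
    have ball: "emeasure lborel (ball (0::real^'n) r) = ennreal (\<omega> * r powr n)" if "0 < r" for r
      using that by (simp add: emeasure_ball \<omega>_def n_def powr_realpow)
    have "Lp_norm q lborel g \<le> ennreal C * ennreal (H * (\<omega> * (2 * \<rho>) powr n) powr a)"
    proof (rule L_op_inequality_nonneg[OF ineq p F])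
      show "0 \<le> F z" for z using h0 by (simp add: F_def)
      show "g \<in> borel_measurable borel" unfolding g_def by measurable
      show "Lp_norm p1 lborel (\<lambda>u. ennreal (F (u, y))) \<le> G y" for y
      proof -
        have "Lp_norm p1 lborel (\<lambda>u. ennreal (F (u, y)))
            = Lp_norm p1 lborel (\<lambda>u. indicator (ball 0 (2 * \<rho>)) y * ennreal (h (- y + 1 *\<^sub>R u)))"
          by (intro arg_cong[where f="Lp_norm p1 lborel"] ext) (auto simp: F_def indicator_def)
        also have "\<dots> \<le> indicator (ball 0 (2 * \<rho>)) y * Lp_norm p1 lborel (\<lambda>u. ennreal (h (- y + 1 *\<^sub>R u)))"
          by (rule Lp_norm_cmult_le[OF p(1)]) measurable
        also have "\<dots> \<le> indicator (ball 0 (2 * \<rho>)) y * Lp_norm p1 lborel (\<lambda>u. ennreal (h u))"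
          by (intro mult_left_mono Lp_norm_dilation_le p) auto
        also have "\<dots> \<le> indicator (ball 0 (2 * \<rho>)) y * ennreal H"
          by (intro mult_left_mono H) auto
        finally show ?thesis by (simp add: G_def mult.commute)
      qed
      show "Lp_norm p2 lborel G \<le> ennreal (H * (\<omega> * (2 * \<rho>) powr n) powr a)"
        unfolding G_def using \<rho> \<omega> H0
        by (subst Lp_norm_cindicator[OF p(2) _ ball]) (auto simp: a_def ennreal_mult)
      show "g x \<le> nn_L_op l (\<lambda>z. ennreal (F z)) x" for x
      proof (cases "x \<in> ball 0 \<rho>")
        case True
        have "ennreal J \<le> ennreal (2 ^ CARD('n)) * (\<integral>\<^sup>+t. ennreal (h (- 2 *\<^sub>R t) * norm (- 2 *\<^sub>R t) powr - l) \<partial>lborel)"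
          using J by (subst (asm) nn_integral_lborel_affine[where c="-2" and t=0]) auto
        also have "(\<integral>\<^sup>+t. ennreal (h (- 2 *\<^sub>R t) * norm (- 2 *\<^sub>R t) powr - l) \<partial>lborel)
          = (\<integral>\<^sup>+t. ennreal (2 powr - l) * (ennreal (F (x - t, x + t)) * ennreal (norm t powr - l)) \<partial>lborel)"
        proof (rule nn_integral_cong)
          fix t :: "real^'n"
          have diff: "x - t - (x + t) = - 2 *\<^sub>R t" by (simp add: scaleR_2)
          \<comment> \<open>The cutoff in \<open>y\<close> is invisible for
            \<open>norm x < \<rho>\<close>: it acts only where \<open>norm t\<close> exceeds
            \<open>\<rho> \<ge> 1\<close>, outside the support of \<open>h\<close>.\<close>
          have "h (- 2 *\<^sub>R t) = 0" if "2 * \<rho> \<le> norm (x + t)"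
          proof -
            have "2 * \<rho> \<le> norm x + norm t" using that norm_triangle_ineq[of x t] by linarith
            then have "1 \<le> norm (- 2 *\<^sub>R t)" using True \<rho> by simp
            then show ?thesis using supp by blast
          qed
          then have "F (x - t, x + t) = h (- 2 *\<^sub>R t)"
            using diff by (auto simp: F_def indicator_def not_less)
          then show "ennreal (h (- 2 *\<^sub>R t) * norm (- 2 *\<^sub>R t) powr - l)
            = ennreal (2 powr - l) * (ennreal (F (x - t, x + t)) * ennreal (norm t powr - l))"
            using h0 by (simp add: ennreal_mult[symmetric] powr_mult mult_ac)
        qed
        also have "\<dots> = ennreal (2 powr - l) * nn_L_op l (\<lambda>z. ennreal (F z)) x"
          unfolding nn_L_op_def by (intro nn_integral_cmult) measurable
        finally have "ennreal (2 powr (l - n)) * ennreal J \<le> ennreal (2 powr (l - n)) * (ennreal (2 ^ CARD('n)) * (ennreal (2 powr - l) * nn_L_op l (\<lambda>z. ennreal (F z)) x))"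
          by (intro mult_left_mono) auto
        also have "\<dots> = ennreal (2 powr (l - n) * 2 powr n * 2 powr - l) * nn_L_op l (\<lambda>z. ennreal (F z)) x"
          by (simp add: ennreal_mult n_def powr_realpow mult.assoc)
        also have "2 powr (l - n) * 2 powr n * 2 powr - l = (1::real)"
          by (simp add: powr_add[symmetric])
        finally show ?thesis using True J0 by (simp add: g_def ennreal_mult)
      qed (simp add: g_def)
    qed
    also have "Lp_norm q lborel g = ennreal (2 powr (l - n) * J) * ennreal ((\<omega> * \<rho> powr n) powr b)"
      unfolding g_def b_def using \<rho> \<omega> by (intro Lp_norm_cindicator p ball) auto
    also have "\<dots> = ennreal (2 powr (l - n) * J * (\<omega> * \<rho> powr n) powr b)"
      using J0 by (simp add: ennreal_mult)
    also have "ennreal C * ennreal (H * (\<omega> * (2 * \<rho>) powr n) powr a)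
        = ennreal (max 0 C * (H * (\<omega> * (2 * \<rho>) powr n) powr a))"
      using H0 by (simp add: ennreal_mult ennreal_max_0)
    finally have "2 powr (l - n) * J * (\<omega> * \<rho> powr n) powr b \<le> max 0 C * (H * (\<omega> * (2 * \<rho>) powr n) powr a)"
      using H0 by (subst (asm) ennreal_le_iff) auto
    then show "J * \<rho> powr (n * b) \<le> K * H * \<rho> powr (n * a)"
      using \<omega> \<rho> by (simp add: K_def powr_mult powr_powr field_simps)
  qed
qed

text \<open>The test function restricts \<open>u + y\<close>, which equals
  \<open>2 *\<^sub>R x\<close> in the integrand, to a small ball. For fixed \<open>y\<close> the
  variable \<open>u\<close> runs over a ball of radius \<open>2 * \<delta>\<close>, whence the power
  \<open>1 / p1\<close> of its volume, whereas for \<open>norm x < \<delta>\<close> the operator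
  does not feel the cutoff.\<close>

lemma L_op_inequality_dilation_small:
  fixes l C :: real
  assumes ineq: "L_op_inequality p1 p2 q l C TYPE('n::finite)"
    and p: "0 < p1" "0 < p2" "0 < q" and l: "0 \<le> l"
  defines "n \<equiv> real CARD('n)"
  shows "\<exists>K\<ge>0. \<forall>(g :: real^'n \<Rightarrow> real) H J r \<delta>. g \<in> borel_measurable borel \<longrightarrow> (\<forall>z. 0 \<le> g z) \<longrightarrow>
     (\<forall>z. norm z < r \<longrightarrow> g z = 0) \<longrightarrow> 0 \<le> H \<longrightarrow> Lp_norm p2 lborel (\<lambda>z. ennreal (g z)) \<le> ennreal H \<longrightarrow>
     0 \<le> J \<longrightarrow> ennreal J \<le> (\<integral>\<^sup>+z. ennreal (g z * norm z powr - l) \<partial>lborel) \<longrightarrow> 0 < \<delta> \<longrightarrow> \<delta> \<le> r \<longrightarrow>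
     J * \<delta> powr (n * enn2real (1 / q)) \<le> K * H * \<delta> powr (n * enn2real (1 / p1))"
proof -
  define a b where "a = enn2real (1 / p1)" and "b = enn2real (1 / q)"
  define \<omega> where "\<omega> = unit_ball_vol n"
  have \<omega>: "0 < \<omega>" by (simp add: \<omega>_def n_def)
  define K where "K = max 0 C * (\<omega> * 2 powr n) powr a / (2 powr - l * \<omega> powr b)"
  show ?thesis
    unfolding a_def[symmetric] b_def[symmetric]
  proof (intro exI[of _ K] conjI allI impI)
    show "0 \<le> K" by (simp add: K_def)
    fix g :: "real^'n \<Rightarrow> real" and H J r \<delta> :: real
    assume [measurable]: "g \<in> borel_measurable borel" and g0: "\<forall>z. 0 \<le> g z"
      and supp: "\<forall>z. norm z < r \<longrightarrow> g z = 0" and H0: "0 \<le> H"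
      and H: "Lp_norm p2 lborel (\<lambda>z. ennreal (g z)) \<le> ennreal H"
      and J0: "0 \<le> J" and J: "ennreal J \<le> (\<integral>\<^sup>+z. ennreal (g z * norm z powr - l) \<partial>lborel)"
      and \<delta>: "0 < \<delta>" "\<delta> \<le> r"
    define F where "F z = indicator {w. norm w < 2 * \<delta>} (fst z + snd z) * g (snd z)" for z
    have F[measurable]: "F \<in> borel_measurable borel"
    proof -
      have "F = (\<lambda>(u, y). indicator {w. norm w < 2 * \<delta>} (u + y) * g y)" by (auto simp: F_def)
      also have "\<dots> \<in> borel_measurable (borel \<Otimes>\<^sub>M borel)" by measurable
      finally show ?thesis by (simp add: borel_prod)
    qed
    have [measurable]: "ball (0::real^'n) r \<in> sets borel" for r by simp
    have ball: "emeasure lborel (ball (y::real^'n) r) = ennreal (\<omega> * r powr n)" if "0 < r" for r y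
      using that by (simp add: emeasure_ball \<omega>_def n_def powr_realpow)
    define v where "v = (\<omega> * (2 * \<delta>) powr n) powr a"
    have "Lp_norm q lborel (\<lambda>x::real^'n. ennreal (2 powr - l * J) * indicator (ball 0 \<delta>) x) \<le> ennreal C * ennreal (v * H)"
    proof (rule L_op_inequality_nonneg[OF ineq p F])
      show "0 \<le> F z" for z using g0 by (simp add: F_def)
      show "Lp_norm p1 lborel (\<lambda>u. ennreal (F (u, y))) \<le> ennreal v * ennreal (g y)" for y
      proof -
        have "Lp_norm p1 lborel (\<lambda>u. ennreal (F (u, y)))
            = Lp_norm p1 lborel (\<lambda>u. ennreal (g y) * indicator (ball (- y) (2 * \<delta>)) u)"
          by (intro arg_cong[where f="Lp_norm p1 lborel"] ext)
             (auto simp: F_def indicator_def dist_norm norm_minus_commute add.commute)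
        also have "\<dots> = ennreal (g y) * ennreal v"
          unfolding v_def a_def using \<delta> \<omega> by (intro Lp_norm_cindicator p ball) auto
        finally show ?thesis by (simp add: mult.commute)
      qed
      show "Lp_norm p2 lborel (\<lambda>y. ennreal v * ennreal (g y)) \<le> ennreal (v * H)"
      proof -
        have "Lp_norm p2 lborel (\<lambda>y. ennreal v * ennreal (g y)) \<le> ennreal v * Lp_norm p2 lborel (\<lambda>y. ennreal (g y))"
          by (intro Lp_norm_cmult_le p) simp
        also have "\<dots> \<le> ennreal v * ennreal H" by (intro mult_left_mono H) auto
        finally show ?thesis using H0 by (simp add: ennreal_mult v_def)
      qed
      show "ennreal (2 powr - l * J) * indicator (ball 0 \<delta>) x \<le> nn_L_op l (\<lambda>z. ennreal (F z)) x" for x :: "real^'n"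
      proof (cases "x \<in> ball 0 \<delta>")
        case True
        have "ennreal (2 powr - l) * ennreal J \<le> ennreal (2 powr - l) * (\<integral>\<^sup>+z. ennreal (g z * norm z powr - l) \<partial>lborel)"
          by (intro mult_left_mono J) auto
        also have "\<dots> = (\<integral>\<^sup>+y. ennreal (2 powr - l) * ennreal (g y * norm y powr - l) \<partial>lborel)"
          by (rule nn_integral_cmult[symmetric]) simp
        also have "\<dots> \<le> (\<integral>\<^sup>+y. ennreal (F (2 *\<^sub>R x - y, y)) * ennreal (norm (y - x) powr - l) \<partial>lborel)"
        proof (rule nn_integral_mono)
          fix y :: "real^'n"
          have F_eq: "F (2 *\<^sub>R x - y, y) = g y" using True by (simp add: F_def)
          show "ennreal (2 powr - l) * ennreal (g y * norm y powr - l)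
            \<le> ennreal (F (2 *\<^sub>R x - y, y)) * ennreal (norm (y - x) powr - l)"
          proof (cases "g y = 0")
            case False
            then have "r \<le> norm y" using supp by (meson not_less)
            \<comment> \<open>As \<open>\<delta> \<le> r\<close>, the support of \<open>g\<close>
              lies farther out than \<open>x\<close>; hence the kernel centred at \<open>x\<close>
              is at least \<open>2 powr - l\<close> times the one centred at the origin.\<close>
            then have xy: "norm x < norm y" using True \<delta> by simp
            then have "norm (y - x) \<le> 2 * norm y" "0 < norm (y - x)"
              using norm_triangle_ineq4[of y x] by auto
            then have "(2 * norm y) powr - l \<le> norm (y - x) powr - l"
              using l by (intro powr_mono2') auto
            then have "2 powr - l * (g y * norm y powr - l) \<le> g y * norm (y - x) powr - l"
              using g0 by (simp add: powr_mult mult_left_mono mult_ac)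
            then show ?thesis unfolding F_eq using g0
              by (simp add: ennreal_mult[symmetric] ennreal_leI)
          qed simp
        qed
        also have "\<dots> = nn_L_op l (\<lambda>z. ennreal (F z)) x"
          by (rule nn_L_op_eq[symmetric]) simp
        finally show ?thesis using True J0 by (simp add: ennreal_mult)
      qed simp
      show "(\<lambda>x::real^'n. ennreal (2 powr - l * J) * indicator (ball 0 \<delta>) x) \<in> borel_measurable borel"
        by measurable
    qed
    also have "Lp_norm q lborel (\<lambda>x::real^'n. ennreal (2 powr - l * J) * indicator (ball 0 \<delta>) x)
        = ennreal (2 powr - l * J) * ennreal ((\<omega> * \<delta> powr n) powr b)"
      unfolding b_def using \<delta> \<omega> by (intro Lp_norm_cindicator p ball) auto
    also have "\<dots> = ennreal (2 powr - l * J * (\<omega> * \<delta> powr n) powr b)"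
      using J0 by (simp add: ennreal_mult)
    also have "ennreal C * ennreal (v * H) = ennreal (max 0 C * (v * H))"
      using H0 by (simp add: ennreal_mult ennreal_max_0 v_def)
    finally have "2 powr - l * J * (\<omega> * \<delta> powr n) powr b \<le> max 0 C * (v * H)"
      using H0 by (subst (asm) ennreal_le_iff) (auto simp: v_def)
    then show "J * \<delta> powr (n * b) \<le> K * H * \<delta> powr (n * a)"
      using \<omega> \<delta> by (simp add: K_def v_def powr_mult powr_powr field_simps)
  qed
qed

text \<open>For \<open>p2 = 1\<close> the indicator of a tiny ball in \<open>y\<close> imitates a
  point mass, and the operator behaves like multiplication of \<open>\<phi>\<close> by the kernel. A
  critical power for \<open>p1\<close> becomes a critical power for \<open>q\<close>, and the number
  of shells enters with powers \<open>a < b\<close>. The volume \<open>V\<close> cancels.\<close>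

lemma L_op_inequality_p2_neq_1:
  fixes l C :: real
  assumes ineq: "L_op_inequality p1 1 q l C TYPE('n::finite)"
    and p: "0 < p1" "0 < q" and l: "0 < l"
    and sum: "enn2real (1 / p1) + l / real CARD('n) = enn2real (1 / q)"
  shows False
proof -
  define n where "n = real CARD('n)"
  define a b where "a = enn2real (1 / p1)" and "b = enn2real (1 / q)"
  have n: "0 < n" by (simp add: n_def)
  have a0: "0 \<le> a" by (simp add: a_def)
  have ab: "a < b" and nb: "n * a + l = n * b"
  proof -
    have "a + l / n = b" using sum by (simp add: a_def b_def n_def)
    then have "b = a + l / n" by simp
    then show "a < b" "n * a + l = n * b" using l n by (simp_all add: distrib_left)
  qed
  obtain c where c: "0 < c" "\<And>k. (\<integral>\<^sup>+x. ennreal (norm (x::real^'n) powr - real DIM(real^'n))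
            * indicator {x. (1/2) ^ k \<le> norm x \<and> norm x < 1} x \<partial>lborel) = ennreal (c * real k)"
    by (rule nn_integral_norm_powr_annulus) (rule that)
  define \<omega> where "\<omega> = unit_ball_vol n"
  have \<omega>: "0 < \<omega>" by (simp add: \<omega>_def n_def)
  have "(c * real k) powr b \<le> max 0 C * 4 powr (n * b) * (c * real (k + 2)) powr a" if k: "1 \<le> k" for k
  proof -
    \<comment> \<open>Half the inner radius of \<open>A\<close>, so that
      \<open>2 *\<^sub>R x - y\<close> and \<open>y - x\<close> have norm at most
      \<open>4 * norm x\<close> for \<open>x\<close> in \<open>A\<close> and \<open>y\<close> in
      \<open>B\<close>.\<close>
    define \<delta> :: real where "\<delta> = (1/2) ^ (k + 3)"
    define \<phi> :: "real^'n \<Rightarrow> real" where "\<phi> = annulus_powr (n * a) (k + 2)"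
    define V where "V = \<omega> * \<delta> powr n"
    have \<delta>: "0 < \<delta>" by (simp add: \<delta>_def)
    have V: "0 < V" using \<omega> \<delta> by (simp add: V_def)
    define B where "B = ball (0::real^'n) \<delta>"
    have [measurable]: "B \<in> sets borel" by (simp add: B_def)
    have B: "emeasure lborel B = ennreal V"
      using \<delta> by (simp add: B_def V_def emeasure_ball \<omega>_def n_def powr_realpow)
    define F where "F z = indicator B (snd z) * \<phi> (fst z)" for z
    have \<phi>[measurable]: "\<phi> \<in> borel_measurable borel" by (simp add: \<phi>_def)
    have F[measurable]: "F \<in> borel_measurable borel"
    proof -
      have "F = (\<lambda>(u, y). indicator B y * \<phi> u)" by (auto simp: F_def)
      also have "\<dots> \<in> borel_measurable (borel \<Otimes>\<^sub>M borel)" by measurable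
      finally show ?thesis by (simp add: borel_prod)
    qed
    define \<Phi> where "\<Phi> = (c * real (k + 2)) powr a"
    have \<Phi>: "Lp_norm p1 lborel (\<lambda>u. ennreal (\<phi> u)) \<le> ennreal \<Phi>"
      unfolding \<phi>_def \<Phi>_def n_def a_def
      using annulus_powr_Lp_norm_critical[OF c p(1), of "k + 2"] by simp
    \<comment> \<open>The annulus with \<open>k\<close> shells, shrunk by \<open>1/4\<close>; it
      keeps \<open>2 *\<^sub>R x - y\<close> inside the annulus of \<open>\<phi>\<close>, which has
      \<open>k + 2\<close> shells.\<close>
    define A where "A = {x::real^'n. 1/4 * (1/2) ^ k \<le> norm x \<and> norm x < 1/4 * 1}"
    have [measurable]: "A \<in> sets borel" unfolding A_def by measurable
    define g where "g x = ennreal (V * 4 powr - (n * b) * norm x powr - (n * b)) * indicator A x" for x :: "real^'n"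
    have "Lp_norm q lborel g \<le> ennreal C * ennreal (\<Phi> * V)"
    proof (rule L_op_inequality_nonneg[OF ineq p(1) zero_less_one p(2) F])
      show "0 \<le> F z" for z by (simp add: F_def \<phi>_def)
      show "g \<in> borel_measurable borel" unfolding g_def by measurable
      show "Lp_norm p1 lborel (\<lambda>u. ennreal (F (u, y))) \<le> ennreal \<Phi> * indicator B y" for y
      proof -
        have "Lp_norm p1 lborel (\<lambda>u. ennreal (F (u, y))) = Lp_norm p1 lborel (\<lambda>u. indicator B y * ennreal (\<phi> u))"
          by (intro arg_cong[where f="Lp_norm p1 lborel"] ext) (auto simp: F_def indicator_def)
        also have "\<dots> \<le> indicator B y * Lp_norm p1 lborel (\<lambda>u. ennreal (\<phi> u))"
          by (intro Lp_norm_cmult_le p) simp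
        also have "\<dots> \<le> indicator B y * ennreal \<Phi>" by (intro mult_left_mono \<Phi>) auto
        finally show ?thesis by (simp add: mult.commute)
      qed
      show "Lp_norm 1 lborel (\<lambda>y. ennreal \<Phi> * indicator B y) \<le> ennreal (\<Phi> * V)"
        using V by (subst Lp_norm_cindicator[OF _ _ B]) (auto simp: ennreal_mult \<Phi>_def)
      show "g x \<le> nn_L_op l (\<lambda>z. ennreal (F z)) x" for x
      proof (cases "x \<in> A")
        case True
        then have x: "2 * \<delta> \<le> norm x" "norm x < 1/4" by (auto simp: A_def \<delta>_def power_add power3_eq_cube)
        then have x0: "0 < norm x" using \<delta> by linarith
        have "g x = (\<integral>\<^sup>+y. ennreal ((4 * norm x) powr - (n * b)) * indicator B y \<partial>lborel)"
          using True V by (subst nn_integral_cmult_indicator) (simp_all add: g_def B powr_mult ennreal_mult mult_ac)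
        also have "\<dots> \<le> (\<integral>\<^sup>+y. ennreal (F (2 *\<^sub>R x - y, y)) * ennreal (norm (y - x) powr - l) \<partial>lborel)"
        proof (rule nn_integral_mono)
          fix y :: "real^'n"
          show "ennreal ((4 * norm x) powr - (n * b)) * indicator B y
              \<le> ennreal (F (2 *\<^sub>R x - y, y)) * ennreal (norm (y - x) powr - l)"
          proof (cases "y \<in> B")
            case y: True
            then have yn: "norm y < \<delta>" by (simp add: B_def)
            have u: "norm x \<le> norm (2 *\<^sub>R x - y)" "norm (2 *\<^sub>R x - y) \<le> 4 * norm x" "norm (2 *\<^sub>R x - y) < 1"
              using norm_triangle_ineq4[of "2 *\<^sub>R x" y] norm_triangle_ineq2[of "2 *\<^sub>R x" y] yn x by auto
            have d: "0 < norm (y - x)" "norm (y - x) \<le> 4 * norm x"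
              using norm_triangle_ineq4[of y x] norm_triangle_ineq2[of x y, unfolded norm_minus_commute[of x y]]
                yn x(1) \<delta> by linarith+
            have "\<phi> (2 *\<^sub>R x - y) = norm (2 *\<^sub>R x - y) powr - (n * a)"
            proof -
              have "(1/2) ^ (k + 2) \<le> norm (2 *\<^sub>R x - y)"
                using u(1) x(1) by (simp add: \<delta>_def power_add power2_eq_square power3_eq_cube)
              then show ?thesis using u(3) by (simp add: \<phi>_def annulus_powr_def)
            qed
            moreover have "(4 * norm x) powr - (n * a) \<le> norm (2 *\<^sub>R x - y) powr - (n * a)"
              using u x0 n a0 by (intro powr_mono2') auto
            moreover have "(4 * norm x) powr - l \<le> norm (y - x) powr - l"
              using d l by (intro powr_mono2') auto
            ultimately have "(4 * norm x) powr - (n * a) * (4 * norm x) powr - l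
                \<le> F (2 *\<^sub>R x - y, y) * norm (y - x) powr - l"
              using y by (auto simp: F_def intro!: mult_mono)
            moreover have "(4 * norm x) powr - (n * a) * (4 * norm x) powr - l = (4 * norm x) powr - (n * b)"
              unfolding powr_add[symmetric] nb[symmetric] by simp
            moreover have "0 \<le> F (2 *\<^sub>R x - y, y)" by (simp add: F_def \<phi>_def)
            ultimately show ?thesis using y by (simp add: ennreal_mult[symmetric] ennreal_leI)
          qed simp
        qed
        also have "\<dots> = nn_L_op l (\<lambda>z. ennreal (F z)) x"
          by (rule nn_L_op_eq[symmetric]) simp
        finally show ?thesis .
      qed (simp add: g_def)
    qed
    also have "Lp_norm q lborel g = ennreal (V * 4 powr - (n * b) * (c * real k) powr b)"
      using p(2)
    proof (cases q rule: exponent_cases)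
      \<comment> \<open>Infinite \<open>q\<close> would give \<open>b = 0\<close>, against
        \<open>0 \<le> a < b\<close>.\<close>
      case infinity
      then show ?thesis using ab a0 by (simp add: b_def)
    next
      case (real r)
      have b: "b = 1 / r" using real by (simp add: b_def)
      have "(\<integral>\<^sup>+x. ennpowr (g x) r \<partial>lborel) = (\<integral>\<^sup>+x. ennreal ((V * 4 powr - (n * b)) powr r) *
          (ennreal (norm (x::real^'n) powr - real DIM(real^'n)) * indicator {x. 1/4 * (1/2) ^ k \<le> norm x \<and> norm x < 1/4 * 1} x) \<partial>lborel)"
        using V real(1) by (intro nn_integral_cong)
          (auto simp: g_def A_def indicator_def powr_mult powr_powr b n_def ennreal_mult[symmetric])
      also have "\<dots> = ennreal ((V * 4 powr - (n * b)) powr r) * (\<integral>\<^sup>+x. ennreal (norm (x::real^'n) powr - real DIM(real^'n)) *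
          indicator {x. 1/4 * (1/2) ^ k \<le> norm x \<and> norm x < 1/4 * 1} x \<partial>lborel)"
        by (rule nn_integral_cmult) measurable
      also have "\<dots> = ennreal ((V * 4 powr - (n * b)) powr r * (c * real k))"
        using c(1) by (subst nn_integral_norm_powr_annulus_scale) (auto simp: c(2)[simplified] ennreal_mult)
      finally show ?thesis using real V c(1) by (simp add: Lp_norm_real powr_mult powr_powr b)
    qed
    also have "ennreal C * ennreal (\<Phi> * V) = ennreal (max 0 C * (\<Phi> * V))"
      using V by (simp add: ennreal_mult ennreal_max_0 \<Phi>_def)
    finally have "V * 4 powr - (n * b) * (c * real k) powr b \<le> max 0 C * (\<Phi> * V)"
      using V by (subst (asm) ennreal_le_iff) (auto simp: \<Phi>_def)
    then have "V * (4 powr - (n * b) * (c * real k) powr b) \<le> V * (max 0 C * \<Phi>)" by (simp add: mult_ac)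
    then have "4 powr - (n * b) * (c * real k) powr b \<le> max 0 C * \<Phi>" using V by simp
    then show ?thesis by (simp add: \<Phi>_def powr_minus field_simps)
  qed
  note main = this
  show False
  proof (rule powr_unbounded)
    show "0 < b - a" using ab by simp
    fix k :: nat assume k: "1 \<le> k"
    define K where "K = max 0 C * 4 powr (n * b)"
    have K: "0 \<le> K" by (simp add: K_def)
    have kpos: "0 < real k" using k by simp
    have "(c * real k) powr b \<le> K * (c * real (k + 2)) powr a" using main[OF k] by (simp add: K_def)
    \<comment> \<open>\<open>k + 2 \<le> 3 * k\<close> because \<open>1 \<le> k\<close>.\<close>
    also have "\<dots> \<le> K * (3 * c * real k) powr a"
      using K k c(1) a0 by (intro mult_left_mono powr_mono2) auto
    finally have "c powr b * real k powr b \<le> K * (3 * c) powr a * real k powr a"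
      using c(1) by (simp add: powr_mult mult_ac)
    moreover have "real k powr b = real k powr (b - a) * real k powr a"
      by (simp add: powr_add[symmetric])
    ultimately have "(c powr b * real k powr (b - a)) * real k powr a \<le> (K * (3 * c) powr a) * real k powr a"
      by (simp add: mult_ac)
    then have "c powr b * real k powr (b - a) \<le> K * (3 * c) powr a"
      using kpos by (simp only: mult_le_cancel_right) (auto simp: not_less)
    then show "real k powr (b - a) \<le> max 0 C * 4 powr (n * b) * (3 * c) powr a / c powr b"
      using c(1) by (simp add: K_def field_simps)
  qed
qed

text \<open>In terms of reciprocals the claim is \<open>a2 < 1\<close>, \<open>b < a2\<close> and
  \<open>a1 < b\<close>. The failure of each is refuted by one family of test functions.\<close>

lemma L_op_inequality_imp_exponents:
  fixes p1 p2 q :: ennreal and l C :: real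
  assumes ineq: "L_op_inequality p1 p2 q l C TYPE('n::finite)"
    and p: "1 \<le> p1" "1 \<le> p2" "0 < q" and l: "0 < l" "l < real CARD('n)"
    and sum: "1 / p1 + 1 / p2 = 1 / q + ennreal ((real CARD('n) - l) / real CARD('n))"
  shows "1 < p2 \<and> p2 < q \<and> q < p1"
proof -
  define n where "n = real CARD('n)"
  define a1 a2 b \<alpha> where "a1 = enn2real (1 / p1)" and "a2 = enn2real (1 / p2)"
    and "b = enn2real (1 / q)" and "\<alpha> = (n - l) / n"
  have pos: "0 < p1" "0 < p2" using p(1,2) by (auto intro: less_le_trans[OF zero_less_one])
  have n: "0 < n" by (simp add: n_def)
  have \<alpha>: "0 < \<alpha>" "\<alpha> < 1" "n * \<alpha> + l = n" using l n by (auto simp: \<alpha>_def n_def)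
  have eq: "a1 + a2 = b + \<alpha>"
    using exponent_relation_real[OF pos p(3) _ sum] l by (simp add: a1_def a2_def b_def \<alpha>_def n_def)
  have nonneg: "0 \<le> a1" "0 \<le> a2" "0 \<le> b" by (simp_all add: a1_def a2_def b_def)
  obtain c where c: "0 < c" "\<And>k. (\<integral>\<^sup>+x. ennreal (norm (x::real^'n) powr - real DIM(real^'n))
            * indicator {x. (1/2) ^ k \<le> norm x \<and> norm x < 1} x \<partial>lborel) = ennreal (c * real k)"
    by (rule nn_integral_norm_powr_annulus) (rule that)
  \<comment> \<open>The exponents \<open>n * \<alpha>\<close> and \<open>l\<close> add up to
    \<open>n\<close>, so the kernel completes the profile to the power with logarithmic
    divergence.\<close>
  have pairing: "ennreal (c * real k) \<le> (\<integral>\<^sup>+z. ennreal (annulus_powr (n * \<alpha>) k (z::real^'n) * norm z powr - l) \<partial>lborel)" for k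
    using \<alpha>(3) by (subst annulus_powr_pairing) (simp_all add: c(2)[simplified] n_def)
  \<comment> \<open>In the borderline cases the critical functions give a logarithmic blow-up.\<close>
  have critical: False if "\<And>k. 1 \<le> k \<Longrightarrow> c * real k \<le> K * (c * real k) powr \<alpha>" for K
  proof (rule powr_unbounded)
    show "0 < 1 - \<alpha>" using \<alpha> by simp
    fix k :: nat assume k: "1 \<le> k"
    have "(c * real k) powr (1 - \<alpha>) * (c * real k) powr \<alpha> = c * real k"
      using c(1) k by (simp add: powr_add[symmetric])
    then have "(c * real k) powr (1 - \<alpha>) * (c * real k) powr \<alpha> \<le> K * (c * real k) powr \<alpha>"
      using that[OF k] by simp
    then have "(c * real k) powr (1 - \<alpha>) \<le> K"
      using c(1) k by (simp only: mult_le_cancel_right) (auto simp: not_less)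
    then show "real k powr (1 - \<alpha>) \<le> K / c powr (1 - \<alpha>)"
      using c(1) by (simp add: powr_mult field_simps)
  qed
  have "a2 < 1"
  proof (rule ccontr)
    assume "\<not> a2 < 1"
    then have "\<not> 1 < p2" using exponent_less_iff[of 1 p2] pos by (simp add: a2_def)
    then have "p2 = 1" using p by simp
    then have "a1 + l / n = b" using eq \<alpha> n by (simp add: a2_def \<alpha>_def diff_divide_distrib)
    then show False
      using L_op_inequality_p2_neq_1[of p1 q l C] ineq \<open>p2 = 1\<close> pos p(3) l(1)
      by (simp add: a1_def b_def n_def)
  qed
  moreover have "b < a2"
  proof (rule ccontr)
    assume nb: "\<not> b < a2"
    obtain K where K: "0 \<le> K" "\<forall>(h :: real^'n \<Rightarrow> real) H J \<rho>. h \<in> borel_measurable borel \<longrightarrow> (\<forall>z. 0 \<le> h z) \<longrightarrow>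
     (\<forall>z. 1 \<le> norm z \<longrightarrow> h z = 0) \<longrightarrow> 0 \<le> H \<longrightarrow> Lp_norm p1 lborel (\<lambda>z. ennreal (h z)) \<le> ennreal H \<longrightarrow>
     0 \<le> J \<longrightarrow> ennreal J \<le> (\<integral>\<^sup>+z. ennreal (h z * norm z powr - l) \<partial>lborel) \<longrightarrow> 1 \<le> \<rho> \<longrightarrow>
     J * \<rho> powr (n * b) \<le> K * H * \<rho> powr (n * a2)"
      using L_op_inequality_dilation_large[OF ineq pos p(3), folded a2_def b_def n_def]
      by (elim exE conjE) (rule that)
    have test: "c * real k * \<rho> powr (n * b) \<le> K * H * \<rho> powr (n * a2)"
      if "0 \<le> H" "Lp_norm p1 lborel (\<lambda>z::real^'n. ennreal (annulus_powr (n * \<alpha>) k z)) \<le> ennreal H" "1 \<le> \<rho>" for k H \<rho>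
      by (rule K(2)[rule_format, OF _ _ _ that(1,2) _ pairing that(3)])
         (use c(1) in \<open>auto simp: annulus_powr_def\<close>)
    show False
    \<comment> \<open>In the case of equality the powers of \<open>\<rho>\<close> cancel and
      \<open>a1 = \<alpha>\<close> makes the profile critical for \<open>p1\<close>, so the number
      of shells tends to infinity. Otherwise the profile keeps one shell and the radius tends to
      infinity.\<close>
    proof (cases "b = a2")
      case True
      then have a1: "a1 = \<alpha>" using eq by simp
      show False
      proof (rule critical)
        fix k :: nat assume "1 \<le> k"
        then have "Lp_norm p1 lborel (\<lambda>z::real^'n. ennreal (annulus_powr (n * \<alpha>) k z)) \<le> ennreal ((c * real k) powr \<alpha>)"
          using annulus_powr_Lp_norm_critical[OF c pos(1), of k] by (simp add: a1[symmetric] a1_def n_def)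
        from test[OF _ this, of 1] show "c * real k \<le> K * (c * real k) powr \<alpha>" by simp
      qed
    next
      case False
      obtain H where H: "0 \<le> H" "Lp_norm p1 lborel (\<lambda>z::real^'n. ennreal (annulus_powr (n * \<alpha>) 1 z)) \<le> ennreal H"
        by (rule annulus_powr_Lp_norm_finite[OF pos(1)]) (rule that)
      show False
      proof (rule powr_unbounded)
        show "0 < n * b - n * a2" using False nb n by simp
        fix k :: nat assume k: "1 \<le> k"
        have "c * (real k powr (n * b - n * a2) * real k powr (n * a2)) = c * real 1 * real k powr (n * b)"
          by (simp add: powr_add[symmetric])
        also have "\<dots> \<le> K * H * real k powr (n * a2)"
          using k by (intro test H) simp
        finally have "(c * real k powr (n * b - n * a2)) * real k powr (n * a2) \<le> K * H * real k powr (n * a2)"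
          by (simp add: mult.assoc)
        then have "c * real k powr (n * b - n * a2) \<le> K * H"
          using k by (simp only: mult_le_cancel_right) (auto simp: not_less)
        then show "real k powr (n * b - n * a2) \<le> K * H / c"
          using c(1) by (simp add: field_simps)
      qed
    qed
  qed
  moreover have "a1 < b"
  proof (rule ccontr)
    assume nb: "\<not> a1 < b"
    obtain K where K: "0 \<le> K" "\<forall>(g :: real^'n \<Rightarrow> real) H J r \<delta>. g \<in> borel_measurable borel \<longrightarrow> (\<forall>z. 0 \<le> g z) \<longrightarrow>
     (\<forall>z. norm z < r \<longrightarrow> g z = 0) \<longrightarrow> 0 \<le> H \<longrightarrow> Lp_norm p2 lborel (\<lambda>z. ennreal (g z)) \<le> ennreal H \<longrightarrow>
     0 \<le> J \<longrightarrow> ennreal J \<le> (\<integral>\<^sup>+z. ennreal (g z * norm z powr - l) \<partial>lborel) \<longrightarrow> 0 < \<delta> \<longrightarrow> \<delta> \<le> r \<longrightarrow>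
     J * \<delta> powr (n * b) \<le> K * H * \<delta> powr (n * a1)"
      using L_op_inequality_dilation_small[OF ineq pos p(3) less_imp_le[OF l(1)], folded a1_def b_def n_def]
      by (elim exE conjE) (rule that)
    have test: "c * real k * \<delta> powr (n * b) \<le> K * H * \<delta> powr (n * a1)"
      if "0 \<le> H" "Lp_norm p2 lborel (\<lambda>z::real^'n. ennreal (annulus_powr (n * \<alpha>) k z)) \<le> ennreal H"
        "0 < \<delta>" "\<delta> \<le> (1/2) ^ k" for k H \<delta>
      by (rule K(2)[rule_format, OF _ _ _ that(1,2) _ pairing that(3,4)])
         (use c(1) in \<open>auto simp: annulus_powr_def\<close>)
    show False
    \<comment> \<open>The same alternative with \<open>p2\<close> in place of \<open>p1\<close> and
      small radii: equality makes \<open>a2 = \<alpha>\<close> and the profile critical for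
      \<open>p2\<close>.\<close>
    proof (cases "b = a1")
      case True
      then have a2: "a2 = \<alpha>" using eq by simp
      show False
      proof (rule critical)
        fix k :: nat assume "1 \<le> k"
        then have "Lp_norm p2 lborel (\<lambda>z::real^'n. ennreal (annulus_powr (n * \<alpha>) k z)) \<le> ennreal ((c * real k) powr \<alpha>)"
          using annulus_powr_Lp_norm_critical[OF c pos(2), of k] by (simp add: a2[symmetric] a2_def n_def)
        from test[OF _ this, of "(1/2) ^ k"] show "c * real k \<le> K * (c * real k) powr \<alpha>"
          unfolding True by (simp add: mult_le_cancel_right)
      qed
    next
      case False
      obtain H where H: "0 \<le> H" "Lp_norm p2 lborel (\<lambda>z::real^'n. ennreal (annulus_powr (n * \<alpha>) 1 z)) \<le> ennreal H"
        by (rule annulus_powr_Lp_norm_finite[OF pos(2)]) (rule that)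
      show False
      proof (rule powr_unbounded)
        show "0 < n * a1 - n * b" using False nb n by simp
        fix k :: nat assume k: "1 \<le> k"
        \<comment> \<open>At most \<open>1/2\<close>, the inner radius of the annulus with one
          shell, and tending to \<open>0\<close> as \<open>k\<close> grows.\<close>
        define \<delta> where "\<delta> = 1 / (2 * real k)"
        have \<delta>: "0 < \<delta>" using k by (simp add: \<delta>_def)
        have "c * real 1 * \<delta> powr (n * b) \<le> K * H * \<delta> powr (n * a1)"
          using k by (intro test H \<delta>) (simp add: \<delta>_def)
        also have "\<dots> = K * H * \<delta> powr (n * a1 - n * b) * \<delta> powr (n * b)"
          by (simp add: powr_add[symmetric])
        finally have "c \<le> K * H * \<delta> powr (n * a1 - n * b)"
          using \<delta> by (simp add: mult_le_cancel_right)
        also have "\<delta> powr (n * a1 - n * b) = 1 / (2 powr (n * a1 - n * b) * real k powr (n * a1 - n * b))"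
          by (simp add: \<delta>_def powr_divide powr_mult)
        finally show "real k powr (n * a1 - n * b) \<le> K * H / 2 powr (n * a1 - n * b) / c"
          using c(1) k by (simp add: field_simps)
      qed
    qed
  qed
  ultimately show ?thesis
    using exponent_less_iff[of 1 p2] exponent_less_iff[OF pos(2) p(3)] exponent_less_iff[OF p(3) pos(1)] pos
    by (simp add: a1_def a2_def b_def)
qed

theorem corollary5p2:
  fixes p1 p2 q :: ennreal and l :: real
  assumes "1 \<le> p1" "p1 \<le> \<infinity>" and "1 \<le> p2" "p2 \<le> \<infinity>" and "0 < q" "q \<le> \<infinity>"
    and "0 < l" "l < real CARD('n::finite)"
    and "1 / p1 + 1 / p2 = 1 / q + ennreal ((real CARD('n) - l) / real CARD('n))"
  shows "(\<exists>C::real. \<forall>f \<in> (mixed_Lp p1 p2 :: ((real^'n) \<times> (real^'n) \<Rightarrow> complex) set).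
            (AE x in lebesgue. integrable lebesgue (L_integrand l f x)) \<and>
            Lp_norm q lebesgue (\<lambda>x. ennreal (cmod (L_op l f x))) \<le> ennreal C * mixed_norm p1 p2 f)
         \<longleftrightarrow> 1 < p2 \<and> p2 < q \<and> q < p1 \<and> p1 \<le> \<infinity>"
proof
  assume "\<exists>C::real. \<forall>f \<in> (mixed_Lp p1 p2 :: ((real^'n) \<times> (real^'n) \<Rightarrow> complex) set).
            (AE x in lebesgue. integrable lebesgue (L_integrand l f x)) \<and>
            Lp_norm q lebesgue (\<lambda>x. ennreal (cmod (L_op l f x))) \<le> ennreal C * mixed_norm p1 p2 f"
  then obtain C where "L_op_inequality p1 p2 q l C TYPE('n)"
    unfolding L_op_inequality_def by blast
  from L_op_inequality_imp_exponents[OF this assms(1,3,5,7,8,9)]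
  show "1 < p2 \<and> p2 < q \<and> q < p1 \<and> p1 \<le> \<infinity>" using assms(2) by blast
next
  assume "1 < p2 \<and> p2 < q \<and> q < p1 \<and> p1 \<le> \<infinity>"
  then show "\<exists>C::real. \<forall>f \<in> (mixed_Lp p1 p2 :: ((real^'n) \<times> (real^'n) \<Rightarrow> complex) set).
            (AE x in lebesgue. integrable lebesgue (L_integrand l f x)) \<and>
            Lp_norm q lebesgue (\<lambda>x. ennreal (cmod (L_op l f x))) \<le> ennreal C * mixed_norm p1 p2 f"
    using L_op_bounded[of p2 q p1 l, where 'n='n] assms(7,8,9) by blast
qed

end
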